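(* For every natural number $n>0$, let $ZW_n=\mathbf{Z}\wr(\mathbf{Z}\times\mathbf{Z}\times\cdots\times\mathbf{Z})$ be the standard restricted wreath product with $n$ factors of $\mathbf{Z}$ in the direct product. Then $ZW_n$ embeds in $PL(I^n)$, and $ZW_n$ also embeds in $PL(S^n)$; that is, there exist injective group homomorphisms $ZW_n\to PL(I^n)$ and $ZW_n\to PL(S^n)$.
   Context: The standard restricted wreath product $C\wr T$ of groups $C$ (bottom group) and $T$ (top group) is the semidirect product $B\rtimes T$, where $B=\bigoplus_{t\in T}C$ (the base group), with multiplication $((a_t)_{t\in T},r)\cdot((b_t)_{t\in T},s)=((c_t)_{t\in T},rs)$, where $c_t=a_t\,b_{t\cdot r}$ for each $t\in T$. For each positive integer $n$, let $I^n_p$ and $S^n_p$ be polyhedra in $\mathbf{R}^n$ and $\mathbf{R}^{n+1}$ which are homeomorphic to the $n$-cube $I^n=[0,1]^n$ and the $n$-sphere $S^n$ respectively, where $\mathbf{R}^{n+1}$ is further required to admit a (hyper)plane of reflective symmetry for $S^n_p$, so that $S^n_p$ is realized as the union of two piecewise-linear homeomorphic images of $I^n_p$, identified together on their common boundary, where one image is the reflection of the other across the plane of symmetry, and their common boundary lies in the plane of symmetry. (So the $n$-sphere is constructed as a doubled $n$-cube.) $\mathrm{Homeo}(I^n)$ and $\mathrm{Homeo}(S^n)$ are the full groups of self-homeomorphisms of $I^n_p$ and $S^n_p$ under composition, and $PL(I^n)$ and $PL(S^n)$ are their respective subgroups consisting of the piecewise-linear self-homeomorphisms. *)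

theory Defs
  imports
    "HOL-Analysis.Analysis"
    "HOL-Algebra.Bij"
    "HOL-Algebra.Elementary_Groups"
    "HOL-Algebra.Product_Groups"
begin

definition wreath_product ::
  "('c, 'm) monoid_scheme \<Rightarrow> ('t, 'k) monoid_scheme \<Rightarrow> (('t \<Rightarrow> 'c) \<times> 't) monoid"
  where
  "wreath_product C T =
    (let B = sum_group (carrier T) (\<lambda>_. C)
     in \<lparr>carrier = carrier B \<times> carrier T,
         monoid.mult = (\<lambda>(a, r) (b, s).
           (a \<otimes>\<^bsub>B\<^esub> (\<lambda>t\<in>carrier T. b (t \<otimes>\<^bsub>T\<^esub> r)), r \<otimes>\<^bsub>T\<^esub> s)),
         one = (\<one>\<^bsub>B\<^esub>, \<one>\<^bsub>T\<^esub>)\<rparr>)"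

definition ZW :: "nat \<Rightarrow> (((nat \<Rightarrow> int) \<Rightarrow> int) \<times> (nat \<Rightarrow> int)) monoid" where
  "ZW n = wreath_product integer_group (product_group {..<n} (\<lambda>_. integer_group))"

(* A compact polyhedron of PL topology, in general not convex; the library's
   polyhedron is instead a finite intersection of half-spaces. *)
definition pl_polyhedron :: "'a::euclidean_space set \<Rightarrow> bool" where
  "pl_polyhedron P \<longleftrightarrow> (\<exists>\<T>. finite \<T> \<and> (\<forall>T\<in>\<T>. polytope T) \<and> \<Union>\<T> = P)"

definition pl_on :: "'a::euclidean_space set \<Rightarrow> ('a \<Rightarrow> 'b::euclidean_space) \<Rightarrow> bool" where
  "pl_on P f \<longleftrightarrow>
    continuous_on P f \<and>
    (\<exists>\<T>. finite \<T> \<and> \<Union>\<T> = P \<and>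
      (\<forall>T\<in>\<T>. polytope T \<and> (\<exists>L c. linear L \<and> (\<forall>x\<in>T. f x = L x + c))))"

(* The inverse of a homeomorphism that is piecewise linear in the sense of pl_on is
   again piecewise linear, so no condition is imposed on it here or in PL_group. *)
definition pl_homeomorphism ::
  "'a::euclidean_space set \<Rightarrow> 'b::euclidean_space set \<Rightarrow> ('a \<Rightarrow> 'b) \<Rightarrow> bool" where
  "pl_homeomorphism P Q f \<longleftrightarrow> (\<exists>g. homeomorphism P Q f g) \<and> pl_on P f"

definition Homeo_group :: "'a::euclidean_space set \<Rightarrow> ('a \<Rightarrow> 'a) monoid" where
  "Homeo_group P =
    (BijGroup P)\<lparr>carrier := {f \<in> carrier (BijGroup P). \<exists>g. homeomorphism P P f g}\<rparr>"

definition PL_group :: "'a::euclidean_space set \<Rightarrow> ('a \<Rightarrow> 'a) monoid" where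
  "PL_group P =
    (Homeo_group P)\<lparr>carrier := {f \<in> carrier (Homeo_group P). pl_on P f}\<rparr>"

definition cube_polyhedron :: "(real ^ 'n) set \<Rightarrow> bool" where
  "cube_polyhedron I \<longleftrightarrow> pl_polyhedron I \<and> I homeomorphic (cbox 0 1 :: (real ^ 'n) set)"

(* Reflection across the hyperplane {x. a \<bullet> x = b}, for a nonzero normal vector a. *)
definition hyperplane_reflection ::
  "'a::euclidean_space \<Rightarrow> real \<Rightarrow> 'a \<Rightarrow> 'a" where
  "hyperplane_reflection a b x = x - (2 * (a \<bullet> x - b) / (a \<bullet> a)) *\<^sub>R a"

(* The sphere as a doubled cube: h embeds the cube I as one half of S. As I lies in
   a Euclidean space of its own dimension, its frontier there is its boundary. *)
definition doubled_cube_sphere :: "(real ^ 'n) set \<Rightarrow> (real ^ 'm) set \<Rightarrow> bool" where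
  "doubled_cube_sphere I S \<longleftrightarrow>
    pl_polyhedron S \<and>
    S homeomorphic (sphere 0 1 :: (real ^ 'm) set) \<and>
    (\<exists>a b h J. a \<noteq> 0 \<and>
      pl_homeomorphism I J h \<and>
      S = J \<union> hyperplane_reflection a b ` J \<and>
      J \<inter> hyperplane_reflection a b ` J = h ` frontier I \<and>
      h ` frontier I \<subseteq> {x. a \<bullet> x = b})"

end

theory Submission
  imports Defs
begin

text \<open>
  A restricted wreath product \<open>C \<wr> T\<close> embeds in a permutation group as soon as that group contains
  an action of \<open>T\<close> and a set \<open>U\<close> carried off itself by every nontrivial element of \<open>T\<close>, together
  with a copy of \<open>C\<close> supported in \<open>U\<close>: the conjugates of this copy have disjoint supports and
  commute, and \<open>T\<close> permutes them (\<open>wreath_product_embeds\<close>). So it suffices to find such data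
  among the piecewise linear homeomorphisms of \<open>I\<close> and of \<open>S\<close>, with \<open>T\<close> free abelian of rank \<open>n\<close>
  and \<open>C\<close> infinite cyclic.

  The homeomorphism between \<open>I\<close> and the standard cube is merely topological, and piecewise linear
  maps cannot be transported along it. Instead a small standard cube is placed inside the interior
  of \<open>I\<close>, which is nonempty by invariance of domain, and maps of that cube are extended by the
  identity to the rest of \<open>I\<close>. This requires the action to be trivial on the frontier of the cube,
  which fails for the obvious action of the integer vectors by products of one-dimensional
  homeomorphisms. The remedy is damping. The map of the \<open>i\<close>-th generator pushes the \<open>i\<close>-th
  coordinate inside the unit interval, and its displacement is reduced by the distance of the point
  from the unit cube, until it vanishes. A coordinate that is pushed contributes nothing to that
  distance, before and after, so all the generators preserve it (\<open>depth_multiflow\<close>); hence they still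
  commute, although each now depends on all coordinates. Everything is expressed by sums, maxima and
  minima of affine functions and is therefore piecewise linear. In the unit cube the action is the
  product action, and it displaces a smaller open cube. A rescaled copy of one of the maps, put into
  this smaller cube, generates the bottom group (\<open>ZW_embeds_in_cube\<close>).

  The resulting maps of \<open>I\<close> fix the frontier of \<open>I\<close>. For the doubled cube \<open>S\<close> they are conjugated by
  the embedding of \<open>I\<close> onto one half and extended by the identity over the mirror image, which meets
  this half only in the image of the frontier. Both extensions are instances of
  \<open>pl_extension_by_identity\<close>.
\<close>

section \<open>Calculus of piecewise linear maps\<close>

definition agrees_affine_on :: "'a::euclidean_space set \<Rightarrow> ('a \<Rightarrow> 'b::euclidean_space) \<Rightarrow> bool" where
  "agrees_affine_on T f \<longleftrightarrow> (\<exists>L c. linear L \<and> (\<forall>x\<in>T. f x = L x + c))"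

lemma pl_on_alt:
  "pl_on P f \<longleftrightarrow> continuous_on P f \<and>
     (\<exists>\<T>. finite \<T> \<and> \<Union>\<T> = P \<and> (\<forall>T\<in>\<T>. polytope T \<and> agrees_affine_on T f))"
  by (simp add: pl_on_def agrees_affine_on_def)

lemma agrees_affine_on_subset: "agrees_affine_on T f \<Longrightarrow> T' \<subseteq> T \<Longrightarrow> agrees_affine_on T' f"
  unfolding agrees_affine_on_def by blast

lemma agrees_affine_on_cong: "agrees_affine_on T f \<Longrightarrow> (\<And>x. x \<in> T \<Longrightarrow> g x = f x) \<Longrightarrow> agrees_affine_on T g"
  unfolding agrees_affine_on_def by simp

lemma agrees_affine_on_compose:
  assumes "agrees_affine_on T f" "agrees_affine_on T' g" "f ` T \<subseteq> T'"
  shows "agrees_affine_on T (\<lambda>x. g (f x))"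
proof -
  obtain L c where L: "linear L" "\<And>x. x \<in> T \<Longrightarrow> f x = L x + c"
    using assms(1) unfolding agrees_affine_on_def by blast
  obtain M d where M: "linear M" "\<And>y. y \<in> T' \<Longrightarrow> g y = M y + d"
    using assms(2) unfolding agrees_affine_on_def by blast
  have "linear (\<lambda>x. M (L x))"
    using linear_compose[OF L(1) M(1)] by (simp add: o_def)
  moreover have "\<forall>x\<in>T. g (f x) = M (L x) + (M c + d)"
    using L M assms(3) by (auto simp: linear_add image_subset_iff)
  ultimately show ?thesis
    unfolding agrees_affine_on_def by blast
qed

lemma pl_on_imp_continuous_on: "pl_on P f \<Longrightarrow> continuous_on P f"
  by (simp add: pl_on_def)

lemma pl_polyhedron_imp_compact: "pl_polyhedron P \<Longrightarrow> compact P"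
  unfolding pl_polyhedron_def using compact_Union polytope_imp_compact by blast

lemma pl_on_imp_pl_polyhedron: "pl_on P f \<Longrightarrow> pl_polyhedron P"
  unfolding pl_on_def pl_polyhedron_def by blast

lemma pl_on_imp_compact: "pl_on P f \<Longrightarrow> compact P"
  by (blast intro: pl_polyhedron_imp_compact pl_on_imp_pl_polyhedron)

lemma pl_on_cong:
  assumes f: "pl_on P f" and eq: "\<And>x. x \<in> P \<Longrightarrow> g x = f x"
  shows "pl_on P g"
proof -
  obtain \<A> where \<A>: "finite \<A>" "\<Union>\<A> = P" "\<forall>T\<in>\<A>. polytope T \<and> agrees_affine_on T f"
    using f unfolding pl_on_alt by blast
  have "agrees_affine_on T g" if "T \<in> \<A>" for T
  proof (rule agrees_affine_on_cong)
    show "agrees_affine_on T f" using \<A>(3) that by blast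
    show "g x = f x" if "x \<in> T" for x
      using eq \<A>(2) that \<open>T \<in> \<A>\<close> by blast
  qed
  moreover have "continuous_on P g"
    using pl_on_imp_continuous_on[OF f] eq by (metis continuous_on_cong)
  ultimately show ?thesis
    using \<A> unfolding pl_on_alt by blast
qed

lemma pl_polyhedron_cbox: "pl_polyhedron (cbox a b)"
  unfolding pl_polyhedron_def by (intro exI[of _ "{cbox a b}"]) (simp add: polytope_interval)

lemma pl_on_affine:
  assumes "pl_polyhedron P" "linear L"
  shows "pl_on P (\<lambda>x. L x + c)"
proof -
  have "continuous_on P (\<lambda>x. L x + c)"
    by (intro continuous_intros linear_continuous_on assms(2)[unfolded linear_conv_bounded_linear])
  then show ?thesis
    using assms unfolding pl_on_def pl_polyhedron_def by metis
qed

lemma pl_on_linear: "pl_polyhedron P \<Longrightarrow> linear L \<Longrightarrow> pl_on P L"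
  using pl_on_affine[of P L 0] by simp

lemma pl_on_const: "pl_polyhedron P \<Longrightarrow> pl_on P (\<lambda>x. c)"
  using pl_on_affine[of P "\<lambda>x. 0" c] linear_zero by simp

lemma pl_on_id: "pl_polyhedron P \<Longrightarrow> pl_on P (\<lambda>x. x)"
  using pl_on_linear linear_id[unfolded id_def] by blast

lemma pl_on_common_pieces:
  assumes "pl_on P f" "pl_on P g"
  obtains \<T> where "finite \<T>" "\<Union>\<T> = P"
    "\<And>T. T \<in> \<T> \<Longrightarrow> polytope T \<and> agrees_affine_on T f \<and> agrees_affine_on T g"
proof -
  obtain \<A> where \<A>: "finite \<A>" "\<Union>\<A> = P" "\<forall>T\<in>\<A>. polytope T \<and> agrees_affine_on T f"
    using assms(1) unfolding pl_on_alt by blast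
  obtain \<B> where \<B>: "finite \<B>" "\<Union>\<B> = P" "\<forall>T\<in>\<B>. polytope T \<and> agrees_affine_on T g"
    using assms(2) unfolding pl_on_alt by blast
  let ?T = "(\<lambda>(A,B). A \<inter> B) ` (\<A> \<times> \<B>)"
  have "finite ?T" using \<A> \<B> by simp
  moreover have "\<Union>?T = P" using \<A>(2) \<B>(2) by (auto 0 3)
  moreover have "polytope T \<and> agrees_affine_on T f \<and> agrees_affine_on T g" if "T \<in> ?T" for T
    using that \<A>(3) \<B>(3) by (auto intro: polytope_Int elim!: agrees_affine_on_subset)
  ultimately show thesis by (rule that)
qed

lemma pl_on_add:
  assumes "pl_on P f" "pl_on P g"
  shows "pl_on P (\<lambda>x. f x + g x)"
proof -
  obtain \<T> where \<T>: "finite \<T>" "\<Union>\<T> = P"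
    "\<And>T. T \<in> \<T> \<Longrightarrow> polytope T \<and> agrees_affine_on T f \<and> agrees_affine_on T g"
    by (rule pl_on_common_pieces[OF assms]) blast
  have "agrees_affine_on T (\<lambda>x. f x + g x)" if "agrees_affine_on T f" "agrees_affine_on T g" for T
  proof -
    from that obtain L c M d where "linear L" "linear M" "\<And>x. x \<in> T \<Longrightarrow> f x = L x + c" "\<And>x. x \<in> T \<Longrightarrow> g x = M x + d"
      unfolding agrees_affine_on_def by blast
    then show ?thesis
      unfolding agrees_affine_on_def
      by (intro exI[of _ "\<lambda>x. L x + M x"] exI[of _ "c + d"]) (auto intro: linear_compose_add)
  qed
  with \<T> show ?thesis
    unfolding pl_on_alt
    by (intro conjI exI[of _ \<T>] continuous_on_add pl_on_imp_continuous_on assms) auto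
qed

lemma pl_on_sum:
  assumes "pl_polyhedron P" "\<And>i. i \<in> A \<Longrightarrow> pl_on P (f i)"
  shows "pl_on P (\<lambda>x. \<Sum>i\<in>A. f i x)"
  using assms(2)
  by (induction A rule: infinite_finite_induct) (auto intro: pl_on_add pl_on_const assms(1))

lemma polyhedron_linear_le:
  fixes L :: "'a::euclidean_space \<Rightarrow> real"
  assumes "linear L"
  shows "polyhedron {x. L x \<le> c}"
proof -
  have "L x = adjoint L 1 \<bullet> x" for x
    using adjoint_works[OF assms, of x 1] by (simp add: inner_commute)
  then show ?thesis
    using polyhedron_halfspace_le[of "adjoint L 1" c] by simp
qed

text \<open>Half-spaces pull back to half-spaces or to trivial sets, and a polyhedron is a finite
  intersection of half-spaces. This is what cuts the pieces of a composite map into polytopes.\<close>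
lemma polyhedron_affine_preimage:
  fixes L :: "'a::euclidean_space \<Rightarrow> 'b::euclidean_space"
  assumes "linear L" "polyhedron S"
  shows "polyhedron {x. L x + c \<in> S}"
proof -
  obtain F where F: "finite F" "S = \<Inter>F" "\<forall>h\<in>F. \<exists>a b. a \<noteq> 0 \<and> h = {x. a \<bullet> x \<le> b}"
    using assms(2) unfolding polyhedron_def by metis
  have "polyhedron {x. L x + c \<in> h}" if h: "h \<in> F" for h
  proof -
    obtain a b where "h = {x. a \<bullet> x \<le> b}"
      using F(3) h by blast
    then have "{x. L x + c \<in> h} = {x. a \<bullet> L x \<le> b - a \<bullet> c}"
      by (auto simp: inner_add_right algebra_simps)
    moreover have "linear (\<lambda>x. a \<bullet> L x)"
      using linear_compose[OF assms(1), of "\<lambda>y. a \<bullet> y"]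
      by (simp add: o_def bounded_linear_inner_right bounded_linear.linear)
    ultimately show ?thesis
      using polyhedron_linear_le by metis
  qed
  then have "polyhedron (\<Inter>((\<lambda>h. {x. L x + c \<in> h}) ` F))"
    using F(1) by (intro polyhedron_Inter) auto
  moreover have "\<Inter>((\<lambda>h. {x. L x + c \<in> h}) ` F) = {x. L x + c \<in> S}"
    using F(2) by auto
  ultimately show ?thesis by simp
qed

text \<open>On a piece \<open>A\<close> of \<open>f\<close>, the points that \<open>f\<close> sends into a piece \<open>B\<close> of \<open>g\<close> form the
  intersection of \<open>A\<close> with an affine preimage of \<open>B\<close>, which is again a polytope.\<close>
lemma pl_on_compose:
  assumes f: "pl_on P f" and g: "pl_on Q g" and sub: "f ` P \<subseteq> Q"
  shows "pl_on P (\<lambda>x. g (f x))"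
proof -
  obtain \<A> where \<A>: "finite \<A>" "\<Union>\<A> = P" "\<forall>T\<in>\<A>. polytope T \<and> agrees_affine_on T f"
    using f unfolding pl_on_alt by blast
  obtain \<B> where \<B>: "finite \<B>" "\<Union>\<B> = Q" "\<forall>T\<in>\<B>. polytope T \<and> agrees_affine_on T g"
    using g unfolding pl_on_alt by blast
  let ?T = "(\<lambda>(A,B). {x\<in>A. f x \<in> B}) ` (\<A> \<times> \<B>)"
  have "finite ?T" using \<A> \<B> by simp
  moreover have "\<Union>?T = P" using \<A>(2) \<B>(2) sub by (auto 0 4 simp: image_subset_iff)
  moreover have "polytope {x\<in>A. f x \<in> B} \<and> agrees_affine_on {x\<in>A. f x \<in> B} (\<lambda>x. g (f x))"
    if AB: "A \<in> \<A>" "B \<in> \<B>" for A B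
  proof
    have "agrees_affine_on A f" using AB \<A>(3) by blast
    then obtain L c where L: "linear L" "\<And>x. x \<in> A \<Longrightarrow> f x = L x + c"
      unfolding agrees_affine_on_def by blast
    have "{x\<in>A. f x \<in> B} = A \<inter> {x. L x + c \<in> B}"
      using L by auto
    moreover have "polyhedron {x. L x + c \<in> B}"
      using AB \<B>(3) L(1) by (intro polyhedron_affine_preimage polytope_imp_polyhedron) auto
    ultimately show "polytope {x\<in>A. f x \<in> B}"
      using AB \<A>(3) by (simp add: polytope_Int_polyhedron)
    have "agrees_affine_on {x\<in>A. f x \<in> B} f" "agrees_affine_on B g"
      using AB \<A>(3) \<B>(3) by (auto elim: agrees_affine_on_subset)
    then show "agrees_affine_on {x\<in>A. f x \<in> B} (\<lambda>x. g (f x))"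
      by (rule agrees_affine_on_compose) auto
  qed
  moreover have "continuous_on P (\<lambda>x. g (f x))"
    using continuous_on_compose2[OF pl_on_imp_continuous_on[OF g] pl_on_imp_continuous_on[OF f] sub] .
  ultimately show ?thesis
    unfolding pl_on_alt by (intro conjI exI[of _ ?T]) auto
qed

lemma pl_on_linear_compose:
  assumes f: "pl_on P f" and L: "linear L"
  shows "pl_on P (\<lambda>x. L (f x))"
proof -
  have "bounded (f ` P)"
    by (intro compact_imp_bounded compact_continuous_image pl_on_imp_continuous_on[OF f] pl_on_imp_compact[OF f])
  then obtain a where "f ` P \<subseteq> cbox (- a) a"
    using bounded_subset_cbox_symmetric by blast
  then show ?thesis
    using pl_on_compose[OF f pl_on_linear[OF pl_polyhedron_cbox L]] by blast
qed

text \<open>Two affine functions are compared by a half-space, so each common piece is cut in two.\<close>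
lemma pl_on_max:
  fixes f g :: "'a::euclidean_space \<Rightarrow> real"
  assumes f: "pl_on P f" and g: "pl_on P g"
  shows "pl_on P (\<lambda>x. max (f x) (g x))"
proof -
  obtain \<T> where \<T>: "finite \<T>" "\<Union>\<T> = P"
    "\<And>T. T \<in> \<T> \<Longrightarrow> polytope T \<and> agrees_affine_on T f \<and> agrees_affine_on T g"
    by (rule pl_on_common_pieces[OF assms]) blast
  have half: "polytope {x\<in>T. u x \<le> v x}"
    if "polytope T" "agrees_affine_on T u" "agrees_affine_on T v" for T and u v :: "'a \<Rightarrow> real"
  proof -
    from that obtain L c M d where "linear L" "linear M" "\<And>x. x \<in> T \<Longrightarrow> u x = L x + c" "\<And>x. x \<in> T \<Longrightarrow> v x = M x + d"
      unfolding agrees_affine_on_def by blast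
    moreover from this have "{x\<in>T. u x \<le> v x} = T \<inter> {x. L x - M x \<le> d - c}"
      by (auto simp: algebra_simps)
    ultimately show ?thesis
      using that(1) by (simp add: polytope_Int_polyhedron polyhedron_linear_le linear_compose_sub)
  qed
  let ?T = "(\<lambda>T. {x\<in>T. f x \<le> g x}) ` \<T> \<union> (\<lambda>T. {x\<in>T. g x \<le> f x}) ` \<T>"
  have "agrees_affine_on {x\<in>T. f x \<le> g x} (\<lambda>x. max (f x) (g x))"
       "agrees_affine_on {x\<in>T. g x \<le> f x} (\<lambda>x. max (f x) (g x))" if "T \<in> \<T>" for T
    using \<T>(3)[OF that] 
    by (auto intro: agrees_affine_on_cong[of _ g] agrees_affine_on_cong[of _ f] elim: agrees_affine_on_subset)
  moreover have "\<Union>?T = P" using \<T>(2) by (auto 0 3)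
  ultimately show ?thesis
    unfolding pl_on_alt using \<T>(1,3)
    by (intro conjI exI[of _ ?T] continuous_on_max pl_on_imp_continuous_on f g) (auto simp: half)
qed

lemma pl_on_scale:
  assumes "pl_on P f"
  shows "pl_on P (\<lambda>x. c *\<^sub>R f x)"
  by (rule pl_on_linear_compose[OF assms]) (simp add: linear_scaleR)

lemma pl_on_mult:
  fixes f :: "'a::euclidean_space \<Rightarrow> real"
  shows "pl_on P f \<Longrightarrow> pl_on P (\<lambda>x. c * f x)"
  using pl_on_scale[of P f c] by simp

lemma pl_on_diff:
  assumes "pl_on P f" "pl_on P g"
  shows "pl_on P (\<lambda>x. f x - g x)"
  using pl_on_add[OF assms(1) pl_on_scale[OF assms(2), of "-1"]] by simp

lemma pl_on_min:
  fixes f g :: "'a::euclidean_space \<Rightarrow> real"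
  assumes "pl_on P f" "pl_on P g"
  shows "pl_on P (\<lambda>x. min (f x) (g x))"
proof -
  have "min (f x) (g x) = - 1 * max (- 1 * f x) (- 1 * g x)" for x
    by (simp add: min_def max_def)
  then show ?thesis
    by (simp only:) (intro pl_on_mult pl_on_max assms)
qed

lemma pl_on_Un:
  assumes f: "pl_on P f" and g: "pl_on Q f"
  shows "pl_on (P \<union> Q) f"
proof -
  obtain \<A> where \<A>: "finite \<A>" "\<Union>\<A> = P" "\<forall>T\<in>\<A>. polytope T \<and> agrees_affine_on T f"
    using f unfolding pl_on_alt by blast
  obtain \<B> where \<B>: "finite \<B>" "\<Union>\<B> = Q" "\<forall>T\<in>\<B>. polytope T \<and> agrees_affine_on T f"
    using g unfolding pl_on_alt by blast
  have "continuous_on (P \<union> Q) f"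
    using f g by (intro continuous_on_closed_Un pl_on_imp_continuous_on compact_imp_closed)
      (auto intro: pl_on_imp_compact)
  then show ?thesis
    using \<A> \<B> unfolding pl_on_alt by (intro conjI exI[of _ "\<A> \<union> \<B>"]) auto
qed

lemma polytope_affine_image:
  assumes "agrees_affine_on T f" "polytope T"
  shows "polytope (f ` T)"
proof -
  obtain L c where L: "linear L" "\<And>x. x \<in> T \<Longrightarrow> f x = L x + c"
    using assms(1) unfolding agrees_affine_on_def by blast
  then have "f ` T = (+) c ` L ` T"
    by (auto simp: image_image image_iff add.commute)
  then show ?thesis
    using L(1) assms(2) by (simp add: polytope_translation_eq polytope_linear_image)
qed

lemma pl_polyhedron_image:
  assumes "pl_on P f"
  shows "pl_polyhedron (f ` P)"
proof -
  obtain \<A> where \<A>: "finite \<A>" "\<Union>\<A> = P" "\<forall>T\<in>\<A>. polytope T \<and> agrees_affine_on T f"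
    using assms unfolding pl_on_alt by blast
  then have "\<forall>T\<in>\<A>. polytope (f ` T)"
    using polytope_affine_image by blast
  then show ?thesis
    unfolding pl_polyhedron_def using \<A>(1,2) by (intro exI[of _ "(`) f ` \<A>"]) auto
qed

text \<open>Injectivity on a convex set makes the linear part injective on the direction space of its
  affine hull: from a relative interior point one can move a little in every such direction.
  A linear left inverse on that space then gives the inverse map.\<close>
lemma agrees_affine_on_inverse:
  fixes f :: "'a::euclidean_space \<Rightarrow> 'b::euclidean_space"
  assumes f: "agrees_affine_on T f" and "convex T" and inj: "inj_on f T"
    and g: "\<And>x. x \<in> T \<Longrightarrow> g (f x) = x"
  shows "agrees_affine_on (f ` T) g"
proof (cases "T = {}")
  case True
  then show ?thesis using linear_zero by (auto simp: agrees_affine_on_def)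
next
  case False
  then obtain p where p: "p \<in> rel_interior T"
    using rel_interior_eq_empty[OF \<open>convex T\<close>] by blast
  then have pT: "p \<in> T" using rel_interior_subset by blast
  obtain L c where L: "linear L" "\<And>x. x \<in> T \<Longrightarrow> f x = L x + c"
    using f unfolding agrees_affine_on_def by blast
  define V where "V = span ((\<lambda>x. x - p) ` T)"
  have aff: "affine hull T = (\<lambda>v. p + v) ` V"
    unfolding V_def using affine_hull_span2[OF pT] 
    by (metis (no_types, lifting) ext affine_hull_span_gen hull_inc pT uminus_add_conv_diff)
  have "inj_on L V"
  proof (subst linear_injective_on_subspace_0[OF L(1)], simp add: V_def, intro ballI impI)
    fix v assume v: "v \<in> V" "L v = 0"
    obtain e where e: "e > 0" "cball p e \<inter> affine hull T \<subseteq> T"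
      using p unfolding mem_rel_interior_cball by blast
    \<comment> \<open>The summand 1 keeps the denominator positive when \<open>v = 0\<close>.\<close>
    define t where "t = e / (1 + norm v)"
    have t: "t > 0" "t * norm v \<le> e"
      using e(1) by (auto simp: t_def field_simps add_pos_nonneg)
    have "t *\<^sub>R v \<in> V" using v(1) by (simp add: V_def span_mul)
    then have "p + t *\<^sub>R v \<in> T"
      using e(2) t aff by (auto simp: dist_norm)
    moreover have "f (p + t *\<^sub>R v) = f p"
      using L pT \<open>p + t *\<^sub>R v \<in> T\<close> v(2) by (simp add: linear_add linear_scale)
    ultimately have "t *\<^sub>R v = 0"
      using inj pT by (metis add.right_neutral add_left_cancel inj_onD)
    then show "v = 0" using t by simp
  qed
  then obtain M where M: "linear M" "\<And>v. v \<in> V \<Longrightarrow> M (L v) = v"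
    using linear_exists_left_inverse_on[OF L(1)] by (metis V_def subspace_span)
  have "g y = M y + (p - M (f p))" if y: "y \<in> f ` T" for y
  proof -
    obtain x where x: "x \<in> T" "y = f x" using y by blast
    have "x - p \<in> V" using x(1) by (simp add: V_def span_base)
    then have "M (L (x - p)) = x - p" using M(2) by blast
    moreover have "L (x - p) = f x - f p" using L x pT by (simp add: linear_diff)
    ultimately have "M (f x) - M (f p) = x - p" using M(1) by (simp add: linear_diff)
    then show ?thesis using g x by (simp add: algebra_simps)
  qed
  then show ?thesis using M(1) unfolding agrees_affine_on_def by blast
qed

lemma pl_on_inverse:
  fixes f :: "'a::euclidean_space \<Rightarrow> 'b::euclidean_space"
  assumes f: "pl_on P f" and g: "\<And>x. x \<in> P \<Longrightarrow> g (f x) = x"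
  shows "pl_on (f ` P) g"
proof -
  obtain \<A> where \<A>: "finite \<A>" "\<Union>\<A> = P" "\<forall>T\<in>\<A>. polytope T \<and> agrees_affine_on T f"
    using f unfolding pl_on_alt by blast
  have inj: "inj_on f P" using g by (metis inj_onI)
  have piece: "polytope (f ` T) \<and> agrees_affine_on (f ` T) g" if T: "T \<in> \<A>" for T
  proof
    have sub: "T \<subseteq> P" using T \<A>(2) by blast
    show "agrees_affine_on (f ` T) g"
      using T \<A>(3) sub g inj
      by (intro agrees_affine_on_inverse) (auto intro: polytope_imp_convex inj_on_subset)
    show "polytope (f ` T)"
      using \<A>(3) T polytope_affine_image by blast
  qed
  have "continuous_on (f ` P) g"
    using continuous_on_inv[OF pl_on_imp_continuous_on[OF f] pl_on_imp_compact[OF f]] g by blast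
  then show ?thesis
    unfolding pl_on_alt using \<A>(1,2) piece by (intro conjI exI[of _ "(`) f ` \<A>"]) auto
qed

section \<open>Wreath products from disjoint translates\<close>

lemma carrier_wreath_product:
  assumes "group C"
  shows "carrier (wreath_product C T) =
    {a \<in> carrier T \<rightarrow>\<^sub>E carrier C. finite {t \<in> carrier T. a t \<noteq> \<one>\<^bsub>C\<^esub>}} \<times> carrier T"
  using assms by (simp add: wreath_product_def Let_def carrier_sum_group)

lemma mult_wreath_product:
  "(a, r) \<otimes>\<^bsub>wreath_product C T\<^esub> (b, s) =
     (\<lambda>t\<in>carrier T. a t \<otimes>\<^bsub>C\<^esub> b (t \<otimes>\<^bsub>T\<^esub> r), r \<otimes>\<^bsub>T\<^esub> s)"
  by (auto simp: wreath_product_def Let_def)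

lemma one_wreath_product:
  "\<one>\<^bsub>wreath_product C T\<^esub> = (\<lambda>t\<in>carrier T. \<one>\<^bsub>C\<^esub>, \<one>\<^bsub>T\<^esub>)"
  by (simp add: wreath_product_def Let_def)

lemma finite_support_translate:
  assumes "group T" "r \<in> carrier T" "finite {t \<in> carrier T. P t}"
  shows "finite {t \<in> carrier T. P (t \<otimes>\<^bsub>T\<^esub> r)}"
proof -
  interpret T: group T by fact
  have "{t \<in> carrier T. P (t \<otimes>\<^bsub>T\<^esub> r)} \<subseteq> (\<lambda>u. u \<otimes>\<^bsub>T\<^esub> inv\<^bsub>T\<^esub> r) ` {t \<in> carrier T. P t}"
  proof
    fix t assume "t \<in> {t \<in> carrier T. P (t \<otimes>\<^bsub>T\<^esub> r)}"
    then show "t \<in> (\<lambda>u. u \<otimes>\<^bsub>T\<^esub> inv\<^bsub>T\<^esub> r) ` {t \<in> carrier T. P t}"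
      using assms(2) by (intro image_eqI[of _ _ "t \<otimes>\<^bsub>T\<^esub> r"]) (auto simp: T.m_assoc)
  qed
  then show ?thesis
    using assms(3) by (meson finite_imageI finite_subset)
qed

lemma group_wreath_product:
  assumes "group C" "group T"
  shows "group (wreath_product C T)"
proof -
  interpret C: group C by fact
  interpret T: group T by fact
  note car = carrier_wreath_product[OF \<open>group C\<close>]
  show ?thesis
  proof (rule groupI)
    fix x y assume "x \<in> carrier (wreath_product C T)" "y \<in> carrier (wreath_product C T)"
    then obtain a r b s where xy: "x = (a, r)" "y = (b, s)"
      and a: "a \<in> carrier T \<rightarrow>\<^sub>E carrier C" "finite {t \<in> carrier T. a t \<noteq> \<one>\<^bsub>C\<^esub>}"
      and b: "b \<in> carrier T \<rightarrow>\<^sub>E carrier C" "finite {t \<in> carrier T. b t \<noteq> \<one>\<^bsub>C\<^esub>}"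
      and rs: "r \<in> carrier T" "s \<in> carrier T"
      unfolding car by blast
    have "finite ({t \<in> carrier T. a t \<noteq> \<one>\<^bsub>C\<^esub>} \<union> {t \<in> carrier T. b (t \<otimes>\<^bsub>T\<^esub> r) \<noteq> \<one>\<^bsub>C\<^esub>})"
      using a(2) finite_support_translate[OF \<open>group T\<close> rs(1) b(2)] by simp
    then have "finite {t \<in> carrier T. a t \<otimes>\<^bsub>C\<^esub> b (t \<otimes>\<^bsub>T\<^esub> r) \<noteq> \<one>\<^bsub>C\<^esub>}"
      by (rule rev_finite_subset) auto
    then have "finite {t \<in> carrier T. (\<lambda>t\<in>carrier T. a t \<otimes>\<^bsub>C\<^esub> b (t \<otimes>\<^bsub>T\<^esub> r)) t \<noteq> \<one>\<^bsub>C\<^esub>}"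
      by (simp cong: conj_cong)
    moreover have "(\<lambda>t\<in>carrier T. a t \<otimes>\<^bsub>C\<^esub> b (t \<otimes>\<^bsub>T\<^esub> r)) \<in> carrier T \<rightarrow>\<^sub>E carrier C"
      using a(1) b(1) rs(1) by (auto simp: PiE_iff)
    ultimately show "x \<otimes>\<^bsub>wreath_product C T\<^esub> y \<in> carrier (wreath_product C T)"
      unfolding xy car mult_wreath_product using rs by simp
  next
    have "{t \<in> carrier T. (\<lambda>t\<in>carrier T. \<one>\<^bsub>C\<^esub>) t \<noteq> \<one>\<^bsub>C\<^esub>} = {}" by auto
    then show "\<one>\<^bsub>wreath_product C T\<^esub> \<in> carrier (wreath_product C T)"
      unfolding car one_wreath_product by auto
  next
    fix x y z
    assume "x \<in> carrier (wreath_product C T)" "y \<in> carrier (wreath_product C T)"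
      "z \<in> carrier (wreath_product C T)"
    then show "x \<otimes>\<^bsub>wreath_product C T\<^esub> y \<otimes>\<^bsub>wreath_product C T\<^esub> z
        = x \<otimes>\<^bsub>wreath_product C T\<^esub> (y \<otimes>\<^bsub>wreath_product C T\<^esub> z)"
      unfolding car
      by (auto simp: mult_wreath_product PiE_iff C.m_assoc T.m_assoc intro!: restrict_ext)
  next
    fix x assume "x \<in> carrier (wreath_product C T)"
    then show "\<one>\<^bsub>wreath_product C T\<^esub> \<otimes>\<^bsub>wreath_product C T\<^esub> x = x"
      unfolding car one_wreath_product
      by (auto simp: mult_wreath_product PiE_iff extensional_def fun_eq_iff)
  next
    fix x assume "x \<in> carrier (wreath_product C T)"
    then obtain a r where x: "x = (a, r)"
      and a: "a \<in> carrier T \<rightarrow>\<^sub>E carrier C" "finite {t \<in> carrier T. a t \<noteq> \<one>\<^bsub>C\<^esub>}"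
      and r: "r \<in> carrier T"
      unfolding car by blast
    define b where "b = (\<lambda>t\<in>carrier T. inv\<^bsub>C\<^esub> a (t \<otimes>\<^bsub>T\<^esub> inv\<^bsub>T\<^esub> r))"
    have "{t \<in> carrier T. b t \<noteq> \<one>\<^bsub>C\<^esub>} \<subseteq> {t \<in> carrier T. a (t \<otimes>\<^bsub>T\<^esub> inv\<^bsub>T\<^esub> r) \<noteq> \<one>\<^bsub>C\<^esub>}"
      by (auto simp: b_def)
    then have "finite {t \<in> carrier T. b t \<noteq> \<one>\<^bsub>C\<^esub>}"
      using finite_support_translate[OF \<open>group T\<close> _ a(2)] r by (meson T.inv_closed finite_subset)
    moreover have "b \<in> carrier T \<rightarrow>\<^sub>E carrier C"
      using a(1) r by (auto simp: b_def PiE_iff)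
    ultimately have "(b, inv\<^bsub>T\<^esub> r) \<in> carrier (wreath_product C T)"
      unfolding car using r by simp
    moreover have "(b, inv\<^bsub>T\<^esub> r) \<otimes>\<^bsub>wreath_product C T\<^esub> x = \<one>\<^bsub>wreath_product C T\<^esub>"
      unfolding x one_wreath_product mult_wreath_product using a(1) r
      by (auto simp: b_def PiE_iff intro!: restrict_ext C.l_inv)
    ultimately show "\<exists>y\<in>carrier (wreath_product C T).
        y \<otimes>\<^bsub>wreath_product C T\<^esub> x = \<one>\<^bsub>wreath_product C T\<^esub>"
      by blast
  qed
qed

lemma mult_BijGroup_apply:
  "f \<in> Bij X \<Longrightarrow> g \<in> Bij X \<Longrightarrow> x \<in> X \<Longrightarrow> (f \<otimes>\<^bsub>BijGroup X\<^esub> g) x = f (g x)"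
  by (simp add: BijGroup_def compose_eq)

text \<open>The setting is a displacement argument: \<open>\<gamma>\<close> represents \<open>C\<close> by permutations that move
  only points of \<open>U\<close>, and every nontrivial element of \<open>T\<close> carries \<open>U\<close> off itself. The
  conjugates of the image of \<open>\<gamma>\<close> by distinct elements of \<open>\<tau>\<close> then have disjoint supports, so
  they commute and generate a direct sum of copies of \<open>C\<close>, which \<open>\<tau>\<close> permutes by
  translation of the index.\<close>
locale disjoint_translates =
  C: group C + T: group T
  for C :: "('c, 'm) monoid_scheme" and T :: "('t, 'k) monoid_scheme" +
  fixes X U :: "'x set" and H :: "('x \<Rightarrow> 'x) set"
    and \<gamma> :: "'c \<Rightarrow> 'x \<Rightarrow> 'x" and \<tau> :: "'t \<Rightarrow> 'x \<Rightarrow> 'x"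
  assumes subgroup_H: "subgroup H (BijGroup X)"
    and \<gamma>_hom: "\<gamma> \<in> hom C (BijGroup X\<lparr>carrier := H\<rparr>)"
    and \<gamma>_inj: "inj_on \<gamma> (carrier C)"
    and \<tau>_hom: "\<tau> \<in> hom T (BijGroup X\<lparr>carrier := H\<rparr>)"
    and U_subset: "U \<subseteq> X" and U_nonempty: "U \<noteq> {}"
    and \<gamma>_support: "\<And>c x. c \<in> carrier C \<Longrightarrow> x \<in> X - U \<Longrightarrow> \<gamma> c x = x"
    and \<tau>_moves_off: "\<And>t x. t \<in> carrier T \<Longrightarrow> t \<noteq> \<one>\<^bsub>T\<^esub> \<Longrightarrow> x \<in> U \<Longrightarrow> \<tau> t x \<notin> U"
begin

lemma H_Bij: "f \<in> H \<Longrightarrow> f \<in> Bij X"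
  using subgroup.subset[OF subgroup_H] by (auto simp: BijGroup_def)

lemma \<gamma>_mem: "c \<in> carrier C \<Longrightarrow> \<gamma> c \<in> H" and \<tau>_mem: "t \<in> carrier T \<Longrightarrow> \<tau> t \<in> H"
  using \<gamma>_hom \<tau>_hom by (auto simp: hom_def)

lemma \<gamma>_closed: "c \<in> carrier C \<Longrightarrow> x \<in> X \<Longrightarrow> \<gamma> c x \<in> X"
  and \<tau>_closed: "t \<in> carrier T \<Longrightarrow> x \<in> X \<Longrightarrow> \<tau> t x \<in> X"
  using H_Bij[OF \<gamma>_mem] H_Bij[OF \<tau>_mem] by (blast dest: Bij_imp_funcset)+

lemma \<gamma>_mult: "c \<in> carrier C \<Longrightarrow> d \<in> carrier C \<Longrightarrow> x \<in> X \<Longrightarrow> \<gamma> (c \<otimes>\<^bsub>C\<^esub> d) x = \<gamma> c (\<gamma> d x)"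
  using \<gamma>_hom mult_BijGroup_apply[OF H_Bij[OF \<gamma>_mem] H_Bij[OF \<gamma>_mem]] by (simp add: hom_def)

lemma \<tau>_mult: "s \<in> carrier T \<Longrightarrow> t \<in> carrier T \<Longrightarrow> x \<in> X \<Longrightarrow> \<tau> (s \<otimes>\<^bsub>T\<^esub> t) x = \<tau> s (\<tau> t x)"
  using \<tau>_hom mult_BijGroup_apply[OF H_Bij[OF \<tau>_mem] H_Bij[OF \<tau>_mem]] by (simp add: hom_def)

lemma group_H: "group (BijGroup X\<lparr>carrier := H\<rparr>)"
  by (rule group.subgroup_imp_group[OF group_BijGroup subgroup_H])

lemma \<gamma>_one: "x \<in> X \<Longrightarrow> \<gamma> \<one>\<^bsub>C\<^esub> x = x"
  using hom_one[OF \<gamma>_hom C.group_axioms group_H] by (simp add: BijGroup_def)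

lemma \<tau>_one: "x \<in> X \<Longrightarrow> \<tau> \<one>\<^bsub>T\<^esub> x = x"
  using hom_one[OF \<tau>_hom T.group_axioms group_H] by (simp add: BijGroup_def)

lemma \<tau>_inv_left: "t \<in> carrier T \<Longrightarrow> x \<in> X \<Longrightarrow> \<tau> (inv\<^bsub>T\<^esub> t) (\<tau> t x) = x"
  using \<tau>_mult[of "inv\<^bsub>T\<^esub> t" t x] by (simp add: \<tau>_one)

lemma \<tau>_inv_right: "t \<in> carrier T \<Longrightarrow> x \<in> X \<Longrightarrow> \<tau> t (\<tau> (inv\<^bsub>T\<^esub> t) x) = x"
  using \<tau>_mult[of t "inv\<^bsub>T\<^esub> t" x] by (simp add: \<tau>_one)

lemma \<gamma>_preserves_U:
  assumes "c \<in> carrier C" "x \<in> U"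
  shows "\<gamma> c x \<in> U"
proof (rule ccontr)
  assume n: "\<gamma> c x \<notin> U"
  have x: "x \<in> X" using assms U_subset by blast
  have "x = \<gamma> (inv\<^bsub>C\<^esub> c) (\<gamma> c x)"
    using \<gamma>_mult[of "inv\<^bsub>C\<^esub> c" c x] assms x by (simp add: \<gamma>_one)
  also have "\<dots> = \<gamma> c x"
    using n assms x by (intro \<gamma>_support) (auto simp: \<gamma>_closed)
  finally show False using n assms by simp
qed

text \<open>The translates of \<open>U\<close> are pairwise disjoint.\<close>
lemma translate_unique:
  assumes "s \<in> carrier T" "t \<in> carrier T" "x \<in> X" "\<tau> s x \<in> U" "\<tau> t x \<in> U"
  shows "s = t"
proof -
  have "\<tau> (t \<otimes>\<^bsub>T\<^esub> inv\<^bsub>T\<^esub> s) (\<tau> s x) = \<tau> t x"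
    using assms by (simp add: \<tau>_mult \<tau>_inv_left \<tau>_closed)
  then have "t \<otimes>\<^bsub>T\<^esub> inv\<^bsub>T\<^esub> s = \<one>\<^bsub>T\<^esub>"
    using \<tau>_moves_off assms by (metis T.inv_closed T.m_closed)
  then show ?thesis
    using assms T.inv_equality T.inv_inv by (metis T.inv_closed)
qed

text \<open>The commuting product over \<open>t\<close> of the conjugates
  \<open>\<tau> (inv t) \<circ> \<gamma> (a t) \<circ> \<tau> t\<close>. At most one factor moves a given point, so the product can be
  written pointwise, without a product operator for a noncommutative group.\<close>
definition \<beta> :: "('t \<Rightarrow> 'c) \<Rightarrow> 'x \<Rightarrow> 'x" where
  "\<beta> a x = (if \<exists>t\<in>carrier T. \<tau> t x \<in> U
     then let t = (THE t. t \<in> carrier T \<and> \<tau> t x \<in> U) in \<tau> (inv\<^bsub>T\<^esub> t) (\<gamma> (a t) (\<tau> t x))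
     else x)"

lemma \<beta>_on_translate:
  assumes "t \<in> carrier T" "x \<in> X" "\<tau> t x \<in> U"
  shows "\<beta> a x = \<tau> (inv\<^bsub>T\<^esub> t) (\<gamma> (a t) (\<tau> t x))"
proof -
  have "(THE t. t \<in> carrier T \<and> \<tau> t x \<in> U) = t"
    using assms translate_unique by blast
  then show ?thesis using assms by (auto simp: \<beta>_def Let_def)
qed

lemma \<beta>_off_translates: "(\<And>t. t \<in> carrier T \<Longrightarrow> \<tau> t x \<notin> U) \<Longrightarrow> \<beta> a x = x"
  by (auto simp: \<beta>_def)

lemma \<tau>_\<beta>:
  assumes "t \<in> carrier T" "x \<in> X" "\<tau> t x \<in> U" "a t \<in> carrier C"
  shows "\<tau> t (\<beta> a x) = \<gamma> (a t) (\<tau> t x)"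
  using assms U_subset by (simp add: \<beta>_on_translate \<tau>_inv_right \<gamma>_closed subset_iff)

lemma \<beta>_closed:
  assumes "a \<in> carrier T \<rightarrow> carrier C" "x \<in> X"
  shows "\<beta> a x \<in> X"
proof (cases "\<exists>t\<in>carrier T. \<tau> t x \<in> U")
  case True
  then obtain t where t: "t \<in> carrier T" "\<tau> t x \<in> U" by blast
  moreover have "a t \<in> carrier C" using assms(1) t(1) by auto
  ultimately show ?thesis using assms(2) by (simp add: \<beta>_on_translate \<tau>_closed \<gamma>_closed)
next
  case False
  then show ?thesis using assms \<beta>_off_translates by auto
qed

lemma \<beta>_mult:
  assumes a: "a \<in> carrier T \<rightarrow> carrier C" and b: "b \<in> carrier T \<rightarrow> carrier C" and x: "x \<in> X"
    and c: "\<And>t. t \<in> carrier T \<Longrightarrow> c t = a t \<otimes>\<^bsub>C\<^esub> b t"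
  shows "\<beta> c x = \<beta> a (\<beta> b x)"
proof (cases "\<exists>t\<in>carrier T. \<tau> t x \<in> U")
  case True
  then obtain t where t: "t \<in> carrier T" "\<tau> t x \<in> U" by blast
  then have at: "a t \<in> carrier C" and bt: "b t \<in> carrier C" using a b by auto
  have "\<tau> t (\<beta> b x) \<in> U"
    using t x bt by (simp add: \<tau>_\<beta> \<gamma>_preserves_U)
  then have "\<beta> a (\<beta> b x) = \<tau> (inv\<^bsub>T\<^esub> t) (\<gamma> (a t) (\<gamma> (b t) (\<tau> t x)))"
    using t x bt b by (simp add: \<beta>_on_translate[of t "\<beta> b x"] \<beta>_closed \<tau>_\<beta>)
  also have "\<dots> = \<beta> c x"
    using t x at bt by (simp add: \<beta>_on_translate c \<gamma>_mult \<tau>_closed)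
  finally show ?thesis by simp
next
  case False
  then show ?thesis by (simp add: \<beta>_off_translates)
qed

text \<open>Conjugation by \<open>\<tau> r\<close> shifts the index by \<open>r\<close>: this is the rule that defines the semidirect
  product.\<close>
lemma \<beta>_translate:
  assumes b: "b \<in> carrier T \<rightarrow> carrier C" and r: "r \<in> carrier T" and x: "x \<in> X"
    and b': "\<And>t. t \<in> carrier T \<Longrightarrow> b' t = b (t \<otimes>\<^bsub>T\<^esub> r)"
  shows "\<tau> r (\<beta> b x) = \<beta> b' (\<tau> r x)"
proof (cases "\<exists>u\<in>carrier T. \<tau> u x \<in> U")
  case True
  then obtain u where u: "u \<in> carrier T" "\<tau> u x \<in> U" by blast
  define t where "t = u \<otimes>\<^bsub>T\<^esub> inv\<^bsub>T\<^esub> r"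
  have t: "t \<in> carrier T" "t \<otimes>\<^bsub>T\<^esub> r = u"
    using u r by (auto simp: t_def T.m_assoc)
  have tr: "\<tau> t (\<tau> r x) = \<tau> u x"
    using t r x \<tau>_mult by metis
  have bu: "b u \<in> carrier C" using b u by auto
  have "\<tau> r (\<beta> b x) = \<tau> (r \<otimes>\<^bsub>T\<^esub> inv\<^bsub>T\<^esub> u) (\<gamma> (b u) (\<tau> u x))"
    using u r x bu by (simp add: \<beta>_on_translate \<tau>_mult \<gamma>_closed \<tau>_closed)
  also have "r \<otimes>\<^bsub>T\<^esub> inv\<^bsub>T\<^esub> u = inv\<^bsub>T\<^esub> t"
    using u r by (simp add: t_def T.inv_mult_group)
  also have "\<tau> (inv\<^bsub>T\<^esub> t) (\<gamma> (b u) (\<tau> u x)) = \<beta> b' (\<tau> r x)"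
    using t u r x tr by (simp add: \<beta>_on_translate[of t "\<tau> r x"] \<tau>_closed b')
  finally show ?thesis .
next
  case False
  have "\<tau> t (\<tau> r x) \<notin> U" if "t \<in> carrier T" for t
    using False that r x \<tau>_mult by (metis T.m_closed)
  then show ?thesis using False by (simp add: \<beta>_off_translates)
qed

lemma \<beta>_trivial:
  assumes "x \<in> X" "\<And>t. t \<in> carrier T \<Longrightarrow> a t = \<one>\<^bsub>C\<^esub>"
  shows "\<beta> a x = x"
  using assms by (cases "\<exists>t\<in>carrier T. \<tau> t x \<in> U")
    (auto simp: \<beta>_on_translate \<gamma>_one \<tau>_closed \<tau>_inv_left \<beta>_off_translates)

lemma mult_H:
  assumes "f \<in> H" "g \<in> H"
  shows "(\<lambda>x\<in>X. f (g x)) \<in> H"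
proof -
  have "f \<otimes>\<^bsub>BijGroup X\<^esub> g = (\<lambda>x\<in>X. f (g x))"
    using assms H_Bij by (simp add: BijGroup_def compose_def)
  then show ?thesis using subgroup.m_closed[OF subgroup_H assms] by simp
qed

lemma \<beta>_in_H_single:
  assumes t: "t \<in> carrier T" "a t \<in> carrier C"
    and off: "\<And>u. u \<in> carrier T \<Longrightarrow> u \<noteq> t \<Longrightarrow> a u = \<one>\<^bsub>C\<^esub>"
  shows "restrict (\<beta> a) X \<in> H"
proof -
  have "\<beta> a x = \<tau> (inv\<^bsub>T\<^esub> t) (\<gamma> (a t) (\<tau> t x))" if x: "x \<in> X" for x
  proof (cases "\<tau> t x \<in> U")
    case True
    then show ?thesis using t x by (simp add: \<beta>_on_translate)
  next
    case False
    have "\<beta> a x = x"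
    proof (cases "\<exists>u\<in>carrier T. \<tau> u x \<in> U")
      case True
      then obtain u where "u \<in> carrier T" "\<tau> u x \<in> U" by blast
      moreover from this False have "u \<noteq> t" by blast
      ultimately show ?thesis
        using x off by (simp add: \<beta>_on_translate \<gamma>_one \<tau>_closed \<tau>_inv_left)
    qed (simp add: \<beta>_off_translates)
    moreover have "\<gamma> (a t) (\<tau> t x) = \<tau> t x"
      using False t x by (simp add: \<gamma>_support \<tau>_closed)
    ultimately show ?thesis using t x by (simp add: \<tau>_inv_left)
  qed
  then have "restrict (\<beta> a) X = (\<lambda>x\<in>X. \<tau> (inv\<^bsub>T\<^esub> t) ((\<lambda>x\<in>X. \<gamma> (a t) (\<tau> t x)) x))"
    by (auto intro: restrict_ext)
  also have "\<dots> \<in> H"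
    using t by (intro mult_H \<tau>_mem \<gamma>_mem) auto
  finally show ?thesis .
qed

text \<open>Here the restriction to finite supports matters: \<open>\<beta> a\<close> is a composition of finitely many
  single conjugates, peeled off one at a time.\<close>
lemma \<beta>_in_H:
  assumes "finite F" "F \<subseteq> carrier T" "a \<in> carrier T \<rightarrow> carrier C"
    "\<And>t. t \<in> carrier T - F \<Longrightarrow> a t = \<one>\<^bsub>C\<^esub>"
  shows "restrict (\<beta> a) X \<in> H"
  using assms
proof (induction F arbitrary: a rule: finite_induct)
  case empty
  then have "restrict (\<beta> a) X = (\<lambda>x\<in>X. x)"
    by (auto intro!: restrict_ext \<beta>_trivial)
  also have "\<dots> \<in> H"
    using subgroup.one_closed[OF subgroup_H] by (simp add: BijGroup_def)
  finally show ?case .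
next
  case (insert t F)
  define a1 where "a1 = a(t := \<one>\<^bsub>C\<^esub>)"
  define a2 where "a2 = (\<lambda>u. if u = t then a t else \<one>\<^bsub>C\<^esub>)"
  have car: "a1 \<in> carrier T \<rightarrow> carrier C" "a2 \<in> carrier T \<rightarrow> carrier C"
    using insert.prems by (auto simp: a1_def a2_def)
  have "restrict (\<beta> a1) X \<in> H"
    using insert.prems car(1) by (intro insert.IH) (auto simp: a1_def)
  moreover have "restrict (\<beta> a2) X \<in> H"
    using insert.prems by (intro \<beta>_in_H_single[of t]) (auto simp: a2_def)
  moreover have "\<beta> a x = \<beta> a1 (\<beta> a2 x)" if "x \<in> X" for x
    using insert.prems by (intro \<beta>_mult car that) (auto simp: a1_def a2_def Pi_iff)
  then have "restrict (\<beta> a) X = (\<lambda>x\<in>X. restrict (\<beta> a1) X (restrict (\<beta> a2) X x))"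
    by (auto intro!: restrict_ext simp: \<beta>_closed car)
  ultimately show ?case using mult_H by metis
qed

text \<open>The map sends \<open>(a, r)\<close> to \<open>\<beta> a \<circ> \<tau> r\<close>. Its kernel is trivial: \<open>\<beta> a\<close> preserves every translate
  of \<open>U\<close>, so a nontrivial \<open>r\<close> would still carry \<open>U\<close> off itself; and if \<open>\<beta> a\<close> is the identity,
  then each \<open>\<gamma> (a t)\<close> is the identity on \<open>U\<close>, hence everywhere.\<close>
theorem wreath_product_embeds:
  "\<exists>\<phi>\<in>hom (wreath_product C T) (BijGroup X\<lparr>carrier := H\<rparr>).
     inj_on \<phi> (carrier (wreath_product C T))"
proof -
  define W where "W = wreath_product C T"
  define K where "K = BijGroup X\<lparr>carrier := H\<rparr>"
  define \<phi> where "\<phi> = (\<lambda>(a, r). \<lambda>x\<in>X. \<beta> a (\<tau> r x))"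
  have car: "carrier W = {a \<in> carrier T \<rightarrow>\<^sub>E carrier C. finite {t \<in> carrier T. a t \<noteq> \<one>\<^bsub>C\<^esub>}} \<times> carrier T"
    unfolding W_def by (rule carrier_wreath_product[OF C.group_axioms])
  have mem: "\<phi> w \<in> H" if "w \<in> carrier W" for w
  proof -
    obtain a r where w: "w = (a, r)" and a: "a \<in> carrier T \<rightarrow> carrier C"
      and fin: "finite {t \<in> carrier T. a t \<noteq> \<one>\<^bsub>C\<^esub>}" and r: "r \<in> carrier T"
      using \<open>w \<in> carrier W\<close> unfolding car by (auto simp: PiE_iff)
    have "restrict (\<beta> a) X \<in> H"
      using fin a by (intro \<beta>_in_H) auto
    from mult_H[OF this \<tau>_mem[OF r]] have "(\<lambda>x\<in>X. restrict (\<beta> a) X (\<tau> r x)) \<in> H" .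
    moreover have "(\<lambda>x\<in>X. restrict (\<beta> a) X (\<tau> r x)) = \<phi> w"
      using r by (auto simp: w \<phi>_def \<tau>_closed intro!: restrict_ext)
    ultimately show ?thesis by simp
  qed
  have mult: "\<phi> (v \<otimes>\<^bsub>W\<^esub> w) = \<phi> v \<otimes>\<^bsub>K\<^esub> \<phi> w" if vw: "v \<in> carrier W" "w \<in> carrier W" for v w
  proof -
    obtain a r b s where v: "v = (a, r)" and w: "w = (b, s)"
      and a: "a \<in> carrier T \<rightarrow> carrier C" and b: "b \<in> carrier T \<rightarrow> carrier C"
      and r: "r \<in> carrier T" and s: "s \<in> carrier T"
      using vw unfolding car by (auto simp: PiE_iff)
    let ?b = "\<lambda>t. b (t \<otimes>\<^bsub>T\<^esub> r)"
    have b': "?b \<in> carrier T \<rightarrow> carrier C" using b r by auto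
    have "\<phi> (v \<otimes>\<^bsub>W\<^esub> w) = (\<lambda>x\<in>X. \<phi> v (\<phi> w x))"
    proof -
      have "\<beta> (\<lambda>t\<in>carrier T. a t \<otimes>\<^bsub>C\<^esub> b (t \<otimes>\<^bsub>T\<^esub> r)) (\<tau> (r \<otimes>\<^bsub>T\<^esub> s) x) = \<phi> v (\<phi> w x)"
        if x: "x \<in> X" for x
      proof -
        have sx: "\<tau> s x \<in> X" "\<tau> r (\<tau> s x) \<in> X" using r s x by (auto simp: \<tau>_closed)
        have "\<beta> (\<lambda>t\<in>carrier T. a t \<otimes>\<^bsub>C\<^esub> b (t \<otimes>\<^bsub>T\<^esub> r)) (\<tau> (r \<otimes>\<^bsub>T\<^esub> s) x)
            = \<beta> a (\<beta> ?b (\<tau> r (\<tau> s x)))"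
          using sx a b' r s x by (simp add: \<tau>_mult \<beta>_mult[of a ?b])
        also have "\<beta> ?b (\<tau> r (\<tau> s x)) = \<tau> r (\<beta> b (\<tau> s x))"
          using \<beta>_translate[OF b r sx(1), of ?b] by simp
        also have "\<beta> a (\<tau> r (\<beta> b (\<tau> s x))) = \<phi> v (\<phi> w x)"
          using x sx b by (simp add: \<phi>_def v w \<beta>_closed)
        finally show ?thesis .
      qed
      then show ?thesis
        by (auto simp: v w \<phi>_def W_def mult_wreath_product intro!: restrict_ext)
    qed
    also have "\<dots> = \<phi> v \<otimes>\<^bsub>K\<^esub> \<phi> w"
      using mem vw H_Bij by (simp add: K_def BijGroup_def compose_def)
    finally show ?thesis .
  qed
  have hom: "\<phi> \<in> hom W K"
    using mem mult by (auto simp: hom_def K_def)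
  have grp: "group W" "group K"
    unfolding W_def K_def
    by (rule group_wreath_product[OF C.group_axioms T.group_axioms], rule group_H)
  have "inj_on \<phi> (carrier W)"
  proof (subst inj_on_one_iff'[OF hom grp], intro allI impI)
    fix w assume w: "w \<in> carrier W" "\<phi> w = \<one>\<^bsub>K\<^esub>"
    obtain a r where ar: "w = (a, r)" and a: "a \<in> carrier T \<rightarrow>\<^sub>E carrier C" and r: "r \<in> carrier T"
      using w(1) unfolding car by auto
    have a': "a \<in> carrier T \<rightarrow> carrier C" using a by (auto simp: PiE_iff)
    have fixed: "\<beta> a (\<tau> r x) = x" if "x \<in> X" for x
      using fun_cong[OF w(2), of x] that by (simp add: ar \<phi>_def K_def BijGroup_def)
    have r1: "r = \<one>\<^bsub>T\<^esub>"
    proof (rule ccontr)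
      assume "r \<noteq> \<one>\<^bsub>T\<^esub>"
      obtain x where xU: "x \<in> U" using U_nonempty by blast
      then have x: "x \<in> X" using U_subset by blast
      have undo_r: "\<tau> (inv\<^bsub>T\<^esub> r) (\<tau> r x) = x" using r x by (simp add: \<tau>_inv_left)
      have a_r: "a (inv\<^bsub>T\<^esub> r) \<in> carrier C" using a' r by auto
      have "\<tau> (inv\<^bsub>T\<^esub> r) (\<beta> a (\<tau> r x)) = \<gamma> (a (inv\<^bsub>T\<^esub> r)) x"
        using \<tau>_\<beta>[of "inv\<^bsub>T\<^esub> r" "\<tau> r x" a] undo_r r x xU a_r by (simp add: \<tau>_closed)
      then have "\<tau> (inv\<^bsub>T\<^esub> r) x \<in> U"
        using fixed[OF x] \<gamma>_preserves_U[OF a_r xU] by simp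
      moreover have "inv\<^bsub>T\<^esub> r \<noteq> \<one>\<^bsub>T\<^esub>" using \<open>r \<noteq> \<one>\<^bsub>T\<^esub>\<close> r by simp
      ultimately show False using \<tau>_moves_off[of "inv\<^bsub>T\<^esub> r" x] r xU by simp
    qed
    have "a t = \<one>\<^bsub>C\<^esub>" if t: "t \<in> carrier T" for t
    proof -
      have at: "a t \<in> carrier C" using a' t by auto
      have "\<gamma> (a t) y = \<gamma> \<one>\<^bsub>C\<^esub> y" if y: "y \<in> X" for y
      proof (cases "y \<in> U")
        case True
        have z: "\<tau> (inv\<^bsub>T\<^esub> t) y \<in> X" "\<tau> t (\<tau> (inv\<^bsub>T\<^esub> t) y) = y"
          using t y by (auto simp: \<tau>_closed \<tau>_inv_right)
        have "\<beta> a (\<tau> (inv\<^bsub>T\<^esub> t) y) = \<tau> (inv\<^bsub>T\<^esub> t) y"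
          using fixed[OF z(1)] z(1) by (simp add: r1 \<tau>_one)
        then have "y = \<gamma> (a t) y"
          using \<tau>_\<beta>[of t "\<tau> (inv\<^bsub>T\<^esub> t) y" a] t z True at by simp
        then show ?thesis using y by (simp add: \<gamma>_one)
      qed (use \<gamma>_support at y \<gamma>_one in auto)
      then have "\<gamma> (a t) = \<gamma> \<one>\<^bsub>C\<^esub>"
        by (intro extensionalityI[of _ X] Bij_imp_extensional H_Bij \<gamma>_mem at C.one_closed)
      then show ?thesis using \<gamma>_inj at by (simp add: inj_on_eq_iff)
    qed
    then have "a = (\<lambda>t\<in>carrier T. \<one>\<^bsub>C\<^esub>)"
      using a by (auto simp: PiE_iff extensional_def)
    then show "w = \<one>\<^bsub>W\<^esub>" by (simp add: ar r1 W_def one_wreath_product)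
  qed
  then show ?thesis using hom unfolding W_def K_def by blast
qed

end

section \<open>Relative piecewise linear groups and extension by the identity\<close>

text \<open>The relative version of the piecewise linear group. Homeomorphisms that fix a boundary can be
  extended by the identity, which is how they are carried from one polyhedron to another.\<close>
definition PL_fixing :: "'a::euclidean_space set \<Rightarrow> 'a set \<Rightarrow> ('a \<Rightarrow> 'a) set" where
  "PL_fixing P A = {f \<in> Bij P. pl_on P f \<and> (\<forall>x\<in>A \<inter> P. f x = x)}"

abbreviation PL_group_fixing :: "'a::euclidean_space set \<Rightarrow> 'a set \<Rightarrow> ('a \<Rightarrow> 'a) monoid" where
  "PL_group_fixing P A \<equiv> BijGroup P\<lparr>carrier := PL_fixing P A\<rparr>"

text \<open>The pieces are compact, so a piecewise linear bijection is automatically a homeomorphism.\<close>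
lemma PL_group_eq: "PL_group P = PL_group_fixing P {}"
proof -
  have "\<exists>g. homeomorphism P P f g" if "f \<in> Bij P" "pl_on P f" for f
    using that by (intro homeomorphism_compact pl_on_imp_compact pl_on_imp_continuous_on)
      (auto simp: Bij_def bij_betw_def)
  then show ?thesis
    by (auto simp: PL_group_def Homeo_group_def PL_fixing_def BijGroup_def)
qed

lemma subgroup_PL_fixing:
  assumes P: "pl_polyhedron P"
  shows "subgroup (PL_fixing P A) (BijGroup P)"
proof (rule group.subgroupI[OF group_BijGroup])
  show "PL_fixing P A \<subseteq> carrier (BijGroup P)"
    by (auto simp: PL_fixing_def BijGroup_def)
  have "(\<lambda>x\<in>P. x) \<in> PL_fixing P A"
    by (auto simp: PL_fixing_def id_Bij intro: pl_on_cong[OF pl_on_id[OF P]])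
  then show "PL_fixing P A \<noteq> {}" by blast
next
  fix f assume f: "f \<in> PL_fixing P A"
  then have bij: "f \<in> Bij P" and im: "f ` P = P" and inj: "inj_on f P"
    by (auto simp: PL_fixing_def Bij_def bij_betw_def)
  have left: "inv_into P f (f x) = x" if "x \<in> P" for x
    using that inj by simp
  have "pl_on (f ` P) (inv_into P f)"
    using f left by (intro pl_on_inverse) (auto simp: PL_fixing_def)
  then have "pl_on P (\<lambda>x\<in>P. inv_into P f x)"
    unfolding im by (rule pl_on_cong) simp
  moreover have "inv_into P f x = x" if "x \<in> A \<inter> P" for x
    using left[of x] f that by (simp add: PL_fixing_def)
  ultimately have "(\<lambda>x\<in>P. inv_into P f x) \<in> PL_fixing P A"
    using restrict_inv_into_Bij[OF bij] by (simp add: PL_fixing_def)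
  then show "inv\<^bsub>BijGroup P\<^esub> f \<in> PL_fixing P A"
    using bij by (simp add: inv_BijGroup)
next
  fix f g assume fg: "f \<in> PL_fixing P A" "g \<in> PL_fixing P A"
  have "g ` P \<subseteq> P" using fg by (auto simp: PL_fixing_def dest: Bij_imp_funcset)
  then have "pl_on P (\<lambda>x. f (g x))"
    using fg by (intro pl_on_compose[of P g P f]) (auto simp: PL_fixing_def)
  then have "pl_on P (compose P f g)"
    by (rule pl_on_cong) (simp add: compose_def)
  then show "f \<otimes>\<^bsub>BijGroup P\<^esub> g \<in> PL_fixing P A"
    using fg by (auto simp: PL_fixing_def BijGroup_def compose_Bij compose_eq)
qed

lemma group_PL_group_fixing: "pl_polyhedron P \<Longrightarrow> group (PL_group_fixing P A)"
  by (rule group.subgroup_imp_group[OF group_BijGroup subgroup_PL_fixing])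

lemma hom_PL_group_fixingI:
  assumes mem: "\<And>x. x \<in> carrier G \<Longrightarrow> f x \<in> PL_fixing P A"
    and mult: "\<And>x y p. x \<in> carrier G \<Longrightarrow> y \<in> carrier G \<Longrightarrow> p \<in> P \<Longrightarrow> f (x \<otimes>\<^bsub>G\<^esub> y) p = f x (f y p)"
    and closed: "\<And>x y. x \<in> carrier G \<Longrightarrow> y \<in> carrier G \<Longrightarrow> x \<otimes>\<^bsub>G\<^esub> y \<in> carrier G"
  shows "f \<in> hom G (PL_group_fixing P A)"
proof (rule homI)
  have bij: "f x \<in> Bij P" if "x \<in> carrier G" for x
    using mem[OF that] by (simp add: PL_fixing_def)
  fix x y assume xy: "x \<in> carrier G" "y \<in> carrier G"
  have "f (x \<otimes>\<^bsub>G\<^esub> y) = compose P (f x) (f y)"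
    using xy mult bij closed
    by (intro extensionalityI[of _ P]) (auto simp: Bij_imp_extensional compose_eq)
  then show "f (x \<otimes>\<^bsub>G\<^esub> y) = f x \<otimes>\<^bsub>PL_group_fixing P A\<^esub> f y"
    using xy bij by (simp add: BijGroup_def)
qed (use mem in auto)

text \<open>Conjugate by \<open>h\<close> and extend by the identity over \<open>K\<close>. The two definitions agree where the
  pieces meet, because that part lies in the image of the fixed set \<open>A\<close>. This lemma serves both
  for transplanting a cube into a polyhedron and for extending over the mirror half of a doubled
  cube.\<close>
theorem pl_extension_by_identity:
  assumes h: "pl_on P h" "inj_on h P" and K: "pl_polyhedron K"
    and A: "A \<subseteq> P" and glue: "h ` P \<inter> K \<subseteq> h ` A" and B: "B \<inter> h ` P \<subseteq> h ` A"
  shows "\<exists>E\<in>hom (PL_group_fixing P A) (PL_group_fixing (h ` P \<union> K) B).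
    inj_on E (PL_fixing P A) \<and>
    (\<forall>f\<in>PL_fixing P A. \<forall>x\<in>(h ` P \<union> K) - h ` P. E f x = x)"
proof -
  define J where "J = h ` P"
  define S where "S = J \<union> K"
  define g where "g = inv_into P h"
  define E where "E f = (\<lambda>x\<in>S. if x \<in> J then h (f (g x)) else x)" for f
  have P: "pl_polyhedron P" using pl_on_imp_pl_polyhedron[OF h(1)] .
  have gh: "g (h p) = p" if "p \<in> P" for p using h(2) that by (simp add: g_def)
  have E_h: "E f (h p) = h (f p)" if "p \<in> P" for f p
    using that by (simp add: E_def S_def J_def gh)
  have E_off: "E f x = x" if "x \<in> S - J" for f x
    using that by (simp add: E_def)
  have closed: "f p \<in> P" if "f \<in> PL_fixing P A" "p \<in> P" for f p
    using that by (auto simp: PL_fixing_def dest: Bij_imp_funcset)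
  have E_A: "E f x = x" if f: "f \<in> PL_fixing P A" and x: "x \<in> h ` A" for f x
  proof -
    obtain p where "p \<in> A" "x = h p" using x by blast
    then show ?thesis using f A by (auto simp: E_h PL_fixing_def)
  qed
  have mem: "E f \<in> PL_fixing S B" if f: "f \<in> PL_fixing P A" for f
  proof -
    have plf: "pl_on P f" and bijf: "bij_betw f P P"
      using f by (auto simp: PL_fixing_def Bij_def)
    have bijh: "bij_betw h P J" using h(2) by (simp add: J_def bij_betw_def)
    have "bij_betw g J P" unfolding g_def by (rule bij_betw_inv_into[OF bijh])
    then have "bij_betw (h \<circ> (f \<circ> g)) J J"
      by (intro bij_betw_trans[OF _ bijh] bij_betw_trans[OF _ bijf])
    then have "bij_betw (E f) J J"
      by (subst bij_betw_cong[of J "E f" "h \<circ> (f \<circ> g)"]) (auto simp: E_def S_def)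
    moreover have "bij_betw (E f) (S - J) (S - J)"
      by (subst bij_betw_cong[of "S - J" "E f" "\<lambda>x. x"]) (auto simp: E_off bij_betw_def)
    ultimately have "bij_betw (E f) (J \<union> (S - J)) (J \<union> (S - J))"
      by (rule bij_betw_combine) auto
    moreover have "J \<union> (S - J) = S" by (auto simp: S_def)
    ultimately have Bij: "E f \<in> Bij S"
      by (simp add: Bij_def E_def)
    have "pl_on J g"
      unfolding J_def by (rule pl_on_inverse[OF h(1) gh])
    then have "pl_on J (\<lambda>x. f (g x))"
      by (rule pl_on_compose[OF _ plf]) (auto simp: J_def gh)
    then have "pl_on J (\<lambda>x. h (f (g x)))"
      by (rule pl_on_compose[OF _ h(1)]) (auto simp: J_def gh closed[OF f])
    then have "pl_on J (E f)"
      by (rule pl_on_cong) (auto simp: E_def S_def)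
    moreover have "pl_on K (E f)"
      using pl_on_id[OF K]
    proof (rule pl_on_cong)
      fix x assume "x \<in> K"
      then show "E f x = x"
        using E_A[OF f] glue E_off by (cases "x \<in> J") (auto simp: J_def S_def)
    qed
    ultimately have "pl_on S (E f)"
      unfolding S_def by (rule pl_on_Un)
    moreover have "E f x = x" if "x \<in> B \<inter> S" for x
      using that E_A[OF f] B E_off by (cases "x \<in> J") (auto simp: J_def)
    ultimately show ?thesis using Bij by (simp add: PL_fixing_def)
  qed
  have "E \<in> hom (PL_group_fixing P A) (PL_group_fixing S B)"
  proof (rule hom_PL_group_fixingI)
    fix f f' x assume ff: "f \<in> carrier (PL_group_fixing P A)" "f' \<in> carrier (PL_group_fixing P A)" and x: "x \<in> S"
    show "E (f \<otimes>\<^bsub>PL_group_fixing P A\<^esub> f') x = E f (E f' x)"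
    proof (cases "x \<in> J")
      case True
      then obtain p where "p \<in> P" "x = h p" by (auto simp: J_def)
      moreover have "(f \<otimes>\<^bsub>PL_group_fixing P A\<^esub> f') p = f (f' p)"
        using ff \<open>p \<in> P\<close> by (simp add: PL_fixing_def mult_BijGroup_apply)
      ultimately show ?thesis using ff by (simp add: E_h closed)
    next
      case False
      then show ?thesis using x by (simp add: E_off)
    qed
  next
    show "x \<otimes>\<^bsub>PL_group_fixing P A\<^esub> y \<in> carrier (PL_group_fixing P A)"
      if "x \<in> carrier (PL_group_fixing P A)" "y \<in> carrier (PL_group_fixing P A)" for x y
      using that monoid.m_closed[OF group.is_monoid[OF group_PL_group_fixing[OF P]]] by blast
  qed (use mem in simp)
  moreover have "inj_on E (PL_fixing P A)"
  proof (rule inj_onI)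
    fix f f' assume ff: "f \<in> PL_fixing P A" "f' \<in> PL_fixing P A" "E f = E f'"
    have "f p = f' p" if p: "p \<in> P" for p
    proof -
      have "h (f p) = h (f' p)" using E_h[OF p] ff(3) by metis
      then show ?thesis using h(2) closed ff(1,2) p by (simp add: inj_on_eq_iff)
    qed
    moreover have "f \<in> extensional P" "f' \<in> extensional P"
      using ff by (auto simp: PL_fixing_def Bij_def)
    ultimately show "f = f'" by (blast intro: extensionalityI)
  qed
  ultimately show ?thesis using E_off unfolding S_def J_def by blast
qed

text \<open>A point avoids an open box exactly if it lies in one of finitely many closed half-spaces.\<close>
lemma pl_polyhedron_Diff_box:
  fixes a b :: "'a::euclidean_space"
  assumes "pl_polyhedron P"
  shows "pl_polyhedron (P - box a b)"
proof -
  obtain \<T> where \<T>: "finite \<T>" "\<forall>T\<in>\<T>. polytope T" "\<Union>\<T> = P"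
    using assms unfolding pl_polyhedron_def by blast
  define \<H> where "\<H> = (\<lambda>i. {x. i \<bullet> x \<le> a \<bullet> i}) ` Basis \<union> (\<lambda>i. {x. i \<bullet> x \<ge> b \<bullet> i}) ` Basis"
  let ?T = "(\<lambda>(T, H). T \<inter> H) ` (\<T> \<times> \<H>)"
  have "polyhedron H" if "H \<in> \<H>" for H
    using that by (auto simp: \<H>_def polyhedron_halfspace_le polyhedron_halfspace_ge)
  then have "\<forall>Q\<in>?T. polytope Q"
    using \<T>(2) by (auto intro: polytope_Int_polyhedron)
  moreover have "finite ?T" using \<T>(1) by (simp add: \<H>_def)
  moreover have "\<Union>\<H> = - box a b"
    by (auto simp: \<H>_def mem_box inner_commute not_less) (meson not_less)+
  then have "\<Union>?T = P - box a b"
    using \<T>(3) by (auto 0 3)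
  ultimately show ?thesis unfolding pl_polyhedron_def by blast
qed

text \<open>A homothety shrinks the cube into \<open>U\<close>. Controlling the support by \<open>U\<close> lets the lemma produce
  maps that live inside a prescribed open set.\<close>
lemma pl_cube_embedding:
  fixes a b :: "'a::euclidean_space" and P U B :: "'a set"
  assumes P: "pl_polyhedron P" and U: "open U" "U \<subseteq> P" "U \<noteq> {}" and ab: "box a b \<noteq> {}"
    and B: "B \<inter> U = {}"
  shows "\<exists>E\<in>hom (PL_group_fixing (cbox a b) (frontier (cbox a b))) (PL_group_fixing P B).
    inj_on E (PL_fixing (cbox a b) (frontier (cbox a b))) \<and>
    (\<forall>f\<in>PL_fixing (cbox a b) (frontier (cbox a b)). \<forall>x\<in>P - U. E f x = x)"
proof -
  obtain c where "c \<in> U" using U(3) by blast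
  then obtain \<rho> where \<rho>: "\<rho> > 0" "ball c \<rho> \<subseteq> U"
    using U(1) open_contains_ball by blast
  obtain M where M: "M > 0" "\<And>x. x \<in> cbox a b \<Longrightarrow> norm x \<le> M"
    using bounded_cbox[of a b] unfolding bounded_pos by blast
  define \<epsilon> where "\<epsilon> = \<rho> / (2 * M)"
  have \<epsilon>: "\<epsilon> > 0" "\<epsilon> * M < \<rho>" using \<rho>(1) M(1) by (auto simp: \<epsilon>_def)
  define h :: "'a \<Rightarrow> 'a" where "h x = \<epsilon> *\<^sub>R x + c" for x
  have hU: "h ` cbox a b \<subseteq> U"
  proof
    fix y assume "y \<in> h ` cbox a b"
    then obtain x where x: "x \<in> cbox a b" "y = \<epsilon> *\<^sub>R x + c" by (auto simp: h_def)
    have "dist c y \<le> \<epsilon> * M"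
      using M(2)[OF x(1)] \<epsilon>(1) by (simp add: x(2) dist_norm)
    then show "y \<in> U" using \<epsilon>(2) \<rho>(2) by auto
  qed
  define K where "K = P - box (h a) (h b)"
  have h: "pl_on (cbox a b) h" "inj_on h (cbox a b)"
    unfolding h_def using \<epsilon>(1)
    by (intro pl_on_affine pl_polyhedron_cbox linear_scaleR, auto simp: inj_on_def)
  have "cbox a b \<noteq> {}" using ab box_subset_cbox by blast
  then have J: "h ` cbox a b = cbox (h a) (h b)"
    unfolding h_def using \<epsilon>(1) by (simp add: image_affinity_cbox)
  have S: "h ` cbox a b \<union> K = P"
    using hU U(2) box_subset_cbox[of "h a" "h b"] by (auto simp: K_def J)
  have "h x \<in> box (h a) (h b)" if "x \<in> box a b" for x
    using that \<epsilon>(1) by (auto simp: mem_box h_def inner_add_left)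
  then have glue: "h ` cbox a b \<inter> K \<subseteq> h ` frontier (cbox a b)"
    by (auto simp: K_def frontier_def)
  have K: "pl_polyhedron K" unfolding K_def by (rule pl_polyhedron_Diff_box[OF P])
  have "frontier (cbox a b) \<subseteq> cbox a b"
    by (intro frontier_subset_closed closed_cbox)
  moreover have "B \<inter> h ` cbox a b \<subseteq> h ` frontier (cbox a b)"
    using B hU by blast
  ultimately have "\<exists>E\<in>hom (PL_group_fixing (cbox a b) (frontier (cbox a b))) (PL_group_fixing P B).
    inj_on E (PL_fixing (cbox a b) (frontier (cbox a b))) \<and>
    (\<forall>f\<in>PL_fixing (cbox a b) (frontier (cbox a b)). \<forall>x\<in>P - h ` cbox a b. E f x = x)"
    using pl_extension_by_identity[OF h K _ glue, of B] unfolding S by blast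
  then show ?thesis using hU by (meson Diff_iff subsetD)
qed

section \<open>A damped action of the integer vectors on a cube\<close>

text \<open>For \<open>d = 0\<close> this homeomorphism of the line moves every point of the open unit interval to the
  right, with slope 2 before \<open>1/3\<close> and slope 1/2 after it. For larger \<open>d\<close> the displacement is
  smaller, and from \<open>d = 1/3\<close> on there is none.\<close>
definition push :: "real \<Rightarrow> real \<Rightarrow> real" where
  "push d s = s + max 0 (min s ((1 - s) / 2) - d)"

text \<open>The inverse of \<open>push d\<close>. As \<open>push d s\<close> is the maximum of \<open>s\<close> and the minimum of \<open>2 * s - d\<close>
  and \<open>(1 + s) / 2 - d\<close>, all increasing, inverting exchanges maxima and minima.\<close>
definition pull :: "real \<Rightarrow> real \<Rightarrow> real" where
  "pull d s = min s (max ((s + d) / 2) (2 * (s + d) - 1))"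

lemma pull_push: "pull d (push d s) = s"
  by (simp add: push_def pull_def max_def min_def field_simps)

lemma push_pull: "push d (pull d s) = s"
  by (simp add: push_def pull_def max_def min_def field_simps)

lemma push_in_Bij: "push d \<in> Bij UNIV"
  unfolding Bij_def
  by (auto intro!: bij_betw_byWitness[of UNIV "pull d"] simp: pull_push push_pull)

text \<open>Working in the permutation group of the line provides the integer powers and their law.\<close>
definition flow :: "real \<Rightarrow> int \<Rightarrow> real \<Rightarrow> real" where
  "flow d k = push d [^]\<^bsub>BijGroup UNIV\<^esub> k"

lemma flow_add: "flow d (j + k) s = flow d j (flow d k s)"
proof -
  interpret group "BijGroup (UNIV :: real set)" by (rule group_BijGroup)
  have Bij: "carrier (BijGroup UNIV) = Bij (UNIV :: real set)"
    by (simp add: BijGroup_def)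
  have car: "push d \<in> carrier (BijGroup UNIV)"
    using push_in_Bij Bij by simp
  then have "flow d j \<in> Bij UNIV" "flow d k \<in> Bij UNIV"
    unfolding flow_def Bij[symmetric] by (rule int_pow_closed)+
  then show ?thesis
    using int_pow_mult[OF car, of j k] by (simp add: flow_def mult_BijGroup_apply)
qed

lemma flow_0: "flow d 0 s = s"
  by (simp add: flow_def BijGroup_def)

lemma flow_1: "flow d 1 = push d"
  using push_in_Bij group.int_pow_1[OF group_BijGroup, of "push d" UNIV]
  by (simp add: flow_def BijGroup_def)

lemma flow_succ: "flow d (k + 1) s = push d (flow d k s)"
  using flow_add[of d 1 k s] by (simp add: flow_1 add.commute)

lemma flow_pred: "flow d (k - 1) s = pull d (flow d k s)"
  using flow_succ[of d "k - 1" s] by (simp add: pull_push)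

lemma flow_induct:
  assumes "P s" "\<And>t. P t \<Longrightarrow> P (push d t)" "\<And>t. P t \<Longrightarrow> P (pull d t)"
  shows "P (flow d k s)"
  by (induction k rule: int_induct[where k = 0]) (auto simp: flow_0 flow_succ flow_pred assms)

lemma flow_fixed:
  assumes "0 \<le> d" "s \<le> 0 \<or> 1 \<le> s \<or> 1 \<le> d"
  shows "flow d k s = s"
proof (rule flow_induct[of "\<lambda>t. t = s"])
  have "push d s = s"
    using assms by (auto simp: push_def max_def min_def field_simps)
  then show "push d t = s" "pull d t = s" if "t = s" for t
    using that pull_push by metis+
qed simp

lemma flow_unit_interval:
  assumes "0 \<le> d" "s \<in> {0..1}"
  shows "flow d k s \<in> {0..1}"
  using assms(2)
  by (rule flow_induct[of "\<lambda>t. t \<in> {0..1}"])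
    (use assms(1) in \<open>auto simp: push_def pull_def max_def min_def field_simps\<close>)

lemma flow_pos_ge:
  assumes "1 / 3 \<le> s"
  shows "2 / 3 \<le> flow 0 (1 + int n) s"
proof -
  have step: "2 / 3 \<le> push 0 t" if "1 / 3 \<le> t" for t
    using that by (auto simp: push_def max_def min_def field_simps)
  show ?thesis
  proof (induction n)
    case 0
    then show ?case using step[OF assms] by (simp add: flow_1)
  next
    case (Suc n)
    have "flow 0 (1 + int (Suc n)) s = push 0 (flow 0 (1 + int n) s)"
      using flow_succ[of 0 "1 + int n" s] by (simp add: algebra_simps)
    then show ?case using step[of "flow 0 (1 + int n) s"] Suc by simp
  qed
qed

text \<open>Since \<open>push 0 (1/3) = 2/3\<close>, positive powers carry the interval to the right of itself, and
  negative powers undo positive ones.\<close>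
lemma flow_disjoint:
  assumes "k \<noteq> 0" "s \<in> {1/3<..<2/3}"
  shows "flow 0 k s \<notin> {1/3<..<2/3}"
proof (cases "k > 0")
  case True
  then have "k = 1 + int (nat (k - 1))" by simp
  then have "2 / 3 \<le> flow 0 k s"
    using flow_pos_ge[of s "nat (k - 1)"] assms(2) by simp
  then show ?thesis by simp
next
  case False
  show ?thesis
  proof
    assume y: "flow 0 k s \<in> {1/3<..<2/3}"
    have "- k = 1 + int (nat (- k - 1))" using False assms(1) by simp
    then have "2 / 3 \<le> flow 0 (- k) (flow 0 k s)"
      using flow_pos_ge[of "flow 0 k s" "nat (- k - 1)"] y by simp
    also have "\<dots> = s" using flow_add[of 0 "- k" k s] by (simp add: flow_0)
    finally show False using assms(2) by simp
  qed
qed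

lemma pl_on_flow:
  assumes P: "pl_polyhedron P" and u: "pl_on P u" and v: "pl_on P v"
  shows "pl_on P (\<lambda>x. flow (u x) k (v x))"
proof (induction k rule: int_induct[where k = 0])
  case base
  then show ?case using v by (simp add: flow_0)
next
  case (step1 k)
  have "flow (u x) (k + 1) (v x) = flow (u x) k (v x)
      + max 0 (min (flow (u x) k (v x)) (1/2 + - (1/2) * flow (u x) k (v x)) - u x)" for x
    by (simp add: flow_succ push_def diff_divide_distrib)
  then show ?case
    by (simp only:) (intro pl_on_add pl_on_max pl_on_min pl_on_diff pl_on_mult pl_on_const P u step1)
next
  case (step2 k)
  have "flow (u x) (k - 1) (v x) = min (flow (u x) k (v x))
      (max (1/2 * (flow (u x) k (v x) + u x)) (2 * (flow (u x) k (v x) + u x) - 1))" for x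
    by (simp add: flow_pred pull_def)
  then show ?case
    by (simp only:) (intro pl_on_add pl_on_max pl_on_min pl_on_diff pl_on_mult pl_on_const P u step2)
qed

definition dist_unit :: "real \<Rightarrow> real" where
  "dist_unit s = max 0 (max (- s) (s - 1))"

text \<open>The distance of \<open>x\<close> from the unit cube in the 1-norm.\<close>
definition depth :: "real ^ 'n \<Rightarrow> real" where
  "depth x = (\<Sum>i\<in>UNIV. dist_unit (x $ i))"

text \<open>The action of the integer vectors: coordinate \<open>i\<close> is pushed \<open>r i\<close> times, damped by the depth.
  On the unit cube it is the product action, and it is the identity at depth at least 1.\<close>
definition multiflow :: "('n \<Rightarrow> int) \<Rightarrow> real ^ 'n \<Rightarrow> real ^ 'n" where
  "multiflow r x = (\<chi> i. flow (depth x) (r i) (x $ i))"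

lemma depth_nonneg: "0 \<le> depth x"
  unfolding depth_def dist_unit_def by (intro sum_nonneg) simp

lemma dist_unit_flow: "0 \<le> d \<Longrightarrow> dist_unit (flow d k s) = dist_unit s"
proof (cases "s \<in> {0..1}")
  case True
  moreover assume "0 \<le> d"
  ultimately have "flow d k s \<in> {0..1}" by (rule flow_unit_interval[rotated])
  then show ?thesis using True by (simp add: dist_unit_def)
qed (auto simp: flow_fixed)

text \<open>The point of the construction. A coordinate moves only while it is in the unit interval, and it
  stays there, so the depth is preserved. Each point is therefore pushed with a constant damping,
  and the pushes of the different coordinates commute.\<close>
lemma depth_multiflow: "depth (multiflow r x) = depth x"
proof -
  have "dist_unit (multiflow r x $ i) = dist_unit (x $ i)" for i
    by (simp add: multiflow_def dist_unit_flow depth_nonneg)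
  then show ?thesis by (simp add: depth_def)
qed

lemma multiflow_add: "multiflow (\<lambda>i. r i + q i) x = multiflow r (multiflow q x)"
  unfolding multiflow_def[of r "multiflow q x"] depth_multiflow
  by (simp add: multiflow_def flow_add vec_eq_iff)

lemma multiflow_0: "multiflow (\<lambda>i. 0) x = x"
  by (simp add: multiflow_def flow_0)

text \<open>Large enough that the depth is at least 1 on its frontier, where the action is thus trivial.\<close>
abbreviation big_cube :: "(real ^ 'n) set" where
  "big_cube \<equiv> cbox (\<chi> i. -1) (\<chi> i. 2)"

abbreviation core :: "(real ^ 'n) set" where
  "core \<equiv> box (\<chi> i. 1/3) (\<chi> i. 2/3)"

lemma core_coordinate: "x \<in> core \<Longrightarrow> x $ i \<in> {1/3<..<2/3}"
  by (simp add: mem_box_cart)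

lemma core_subset_big_cube: "core \<subseteq> big_cube"
proof
  fix x :: "real ^ 'n" assume "x \<in> core"
  then have "-1 \<le> x $ i \<and> x $ i \<le> 2" for i
    using core_coordinate[of x i] by simp
  then show "x \<in> big_cube" by (simp add: mem_box_cart)
qed

lemma big_cube_interior_nonempty: "box (\<chi> i. -1) (\<chi> i. 2) \<noteq> ({} :: (real ^ 'n) set)"
proof -
  have "(0 :: real ^ 'n) \<in> box (\<chi> i. -1) (\<chi> i. 2)" by (simp add: mem_box_cart)
  then show ?thesis by blast
qed

lemma depth_eq_0_core:
  assumes "x \<in> core"
  shows "depth x = 0"
proof -
  have "dist_unit (x $ i) = 0" for i
    using core_coordinate[OF assms, of i] by (simp add: dist_unit_def)
  then show ?thesis by (simp add: depth_def)
qed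

lemma multiflow_big_cube: "x \<in> big_cube \<Longrightarrow> multiflow r x \<in> big_cube"
proof -
  assume x: "x \<in> big_cube"
  have "flow (depth x) (r i) (x $ i) \<in> {-1..2}" for i
  proof (cases "x $ i \<in> {0..1}")
    case True
    then show ?thesis using flow_unit_interval[OF depth_nonneg True, of x "r i"] by simp
  next
    case False
    then have "flow (depth x) (r i) (x $ i) = x $ i" by (intro flow_fixed depth_nonneg) auto
    then show ?thesis using x by (simp add: mem_box_cart)
  qed
  then show ?thesis by (simp add: mem_box_cart multiflow_def)
qed

lemma multiflow_frontier:
  fixes x :: "real ^ 'n"
  assumes x: "x \<in> frontier big_cube"
  shows "multiflow r x = x"
proof -
  have "x \<in> big_cube - box (\<chi> i. -1) (\<chi> i. 2)"
    using x by (simp add: frontier_def)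
  then obtain j where "x $ j \<le> -1 \<or> x $ j \<ge> 2"
    by (auto simp: mem_box_cart not_less)
  then have "1 \<le> dist_unit (x $ j)" by (auto simp: dist_unit_def)
  also have "\<dots> \<le> depth x"
    unfolding depth_def by (rule member_le_sum) (auto simp: dist_unit_def)
  finally show ?thesis
    by (simp add: multiflow_def flow_fixed)
qed

lemma pl_on_multiflow:
  assumes P: "pl_polyhedron P"
  shows "pl_on P (multiflow r)"
proof -
  have coord: "pl_on P (\<lambda>x. x $ i)" for i
    by (intro pl_on_linear P bounded_linear.linear bounded_linear_vec_nth)
  have "pl_on P depth"
    unfolding depth_def[abs_def] dist_unit_def
    by (intro pl_on_sum pl_on_max pl_on_const P pl_on_diff coord)
       (use pl_on_scale[OF coord, of "-1"] in simp)
  then have fl: "pl_on P (\<lambda>x. flow (depth x) (r i) (x $ i))" for i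
    by (intro pl_on_flow P coord)
  have "pl_on P (\<lambda>x. \<Sum>i\<in>UNIV. flow (depth x) (r i) (x $ i) *\<^sub>R axis i 1)"
    by (intro pl_on_sum P pl_on_linear_compose[OF fl])
       (simp add: bounded_linear.linear bounded_linear_scaleR_left)
  moreover have "multiflow r x = (\<Sum>i\<in>UNIV. flow (depth x) (r i) (x $ i) *\<^sub>R axis i 1)" for x
    by (simp add: multiflow_def vec_eq_iff axis_def if_distrib[of "\<lambda>c. _ * c"] cong: if_cong)
  ultimately show ?thesis by (rule pl_on_cong)
qed

lemma multiflow_in_PL_fixing: "restrict (multiflow r) big_cube \<in> PL_fixing big_cube (frontier big_cube)"
proof -
  have "multiflow (\<lambda>i. - r i) (multiflow r x) = x" "multiflow r (multiflow (\<lambda>i. - r i) x) = x" for x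
    using multiflow_add[of "\<lambda>i. - r i" r x] multiflow_add[of r "\<lambda>i. - r i" x] by (simp_all add: multiflow_0)
  then have "bij_betw (multiflow r) big_cube big_cube"
    using multiflow_big_cube
    by (intro bij_betw_byWitness[of _ "multiflow (\<lambda>i. - r i)"]) blast+
  moreover have "pl_on big_cube (restrict (multiflow r) big_cube)"
    by (rule pl_on_cong[OF pl_on_multiflow[OF pl_polyhedron_cbox]]) simp
  ultimately show ?thesis
    by (auto simp: PL_fixing_def Bij_def multiflow_frontier)
qed

lemma multiflow_moves_off_core:
  assumes "r i \<noteq> 0" "x \<in> core"
  shows "multiflow r x \<notin> core"
proof
  assume "multiflow r x \<in> core"
  then have "flow 0 (r i) (x $ i) \<in> {1/3<..<2/3}"
    using assms(2) by (simp add: mem_box_cart multiflow_def depth_eq_0_core)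
  then show False using flow_disjoint[OF assms(1) core_coordinate[OF assms(2)]] by blast
qed

text \<open>The top group acts by \<open>multiflow\<close>. For the generator of the bottom group, a shrunken copy of the
  big cube is placed in the core, and the simultaneous push of all coordinates is transplanted to
  it; it has infinite order, and its support is displaced by the top group.\<close>
theorem ZW_embeds_in_cube:
  assumes n: "CARD('n::finite) = n"
  shows "\<exists>\<phi>\<in>hom (ZW n) (PL_group_fixing (big_cube :: (real ^ 'n) set) (frontier big_cube)).
    inj_on \<phi> (carrier (ZW n))"
proof -
  let ?C = "big_cube :: (real ^ 'n) set" and ?U = "core :: (real ^ 'n) set"
  let ?G = "PL_group_fixing ?C (frontier ?C)"
  let ?T = "product_group {..<n} (\<lambda>_. integer_group)"
  have G: "group ?G" by (rule group_PL_group_fixing[OF pl_polyhedron_cbox])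
  obtain e :: "'n \<Rightarrow> nat" where e: "bij_betw e UNIV {..<n}"
    using ex_bij_betw_finite_nat[of "UNIV :: 'n set"] n by (auto simp: lessThan_atLeast0)
  then have e_less: "e i < n" for i by (auto simp: bij_betw_def)
  define \<tau> where "\<tau> r = restrict (multiflow (\<lambda>i. r (e i))) ?C" for r :: "nat \<Rightarrow> int"
  define diag where "diag k = restrict (multiflow (\<lambda>i. k)) ?C" for k :: int
  have core_sub: "?U \<subseteq> ?C" by (rule core_subset_big_cube)
  have half: "(\<chi> i. 1/2) \<in> ?U" by (simp add: mem_box_cart)
  have T: "group ?T" by simp
  have \<tau>: "\<tau> \<in> hom ?T ?G"
  proof (rule hom_PL_group_fixingI)
    show "\<tau> r \<in> PL_fixing ?C (frontier ?C)" for r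
      unfolding \<tau>_def by (rule multiflow_in_PL_fixing)
    show "\<tau> (r \<otimes>\<^bsub>?T\<^esub> q) p = \<tau> r (\<tau> q p)" if "p \<in> ?C" for r q p
      using that e_less by (simp add: \<tau>_def multiflow_big_cube multiflow_add)
    show "r \<otimes>\<^bsub>?T\<^esub> q \<in> carrier ?T" if "r \<in> carrier ?T" "q \<in> carrier ?T" for r q
      using that T by (meson group.is_monoid monoid.m_closed)
  qed
  have diag: "diag \<in> hom integer_group ?G"
  proof (rule hom_PL_group_fixingI)
    show "diag k \<in> PL_fixing ?C (frontier ?C)" for k
      unfolding diag_def by (rule multiflow_in_PL_fixing)
    show "diag (j \<otimes>\<^bsub>integer_group\<^esub> k) p = diag j (diag k p)" if "p \<in> ?C" for j k p
      using that multiflow_add[of "\<lambda>i. j" "\<lambda>i. k" p] by (simp add: diag_def multiflow_big_cube)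
  qed simp
  have diag_inj: "inj_on diag (carrier integer_group)"
  proof (subst inj_on_one_iff'[OF diag group_integer_group G], intro allI impI)
    fix k assume "diag k = \<one>\<^bsub>?G\<^esub>"
    then have "diag k (\<chi> i. 1/2) = (\<lambda>x\<in>?C. x) (\<chi> i. 1/2)"
      by (simp add: BijGroup_def)
    moreover have "(\<chi> i. 1/2) \<in> ?C" using half core_sub by blast
    ultimately have "multiflow (\<lambda>i::'n. k) (\<chi> i. 1/2) = (\<chi> i. 1/2)"
      by (simp add: diag_def)
    then show "k = \<one>\<^bsub>integer_group\<^esub>"
      using multiflow_moves_off_core[OF _ half, of "\<lambda>i. k"] half by fastforce
  qed
  have "frontier ?C \<inter> ?U = {}"
  proof -
    have "?U \<subseteq> interior ?C" by (rule interior_maximal[OF core_sub open_box])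
    then show ?thesis unfolding frontier_def by blast
  qed
  then obtain E where E: "E \<in> hom ?G ?G" "inj_on E (PL_fixing ?C (frontier ?C))"
    "\<And>f x. f \<in> PL_fixing ?C (frontier ?C) \<Longrightarrow> x \<in> ?C - ?U \<Longrightarrow> E f x = x"
    using pl_cube_embedding[OF pl_polyhedron_cbox open_box core_sub _ big_cube_interior_nonempty, of "frontier ?C"] half by blast
  interpret disjoint_translates integer_group ?T ?C ?U "PL_fixing ?C (frontier ?C)" "E \<circ> diag" \<tau>
  proof (intro disjoint_translates.intro disjoint_translates_axioms.intro)
    show "subgroup (PL_fixing ?C (frontier ?C)) (BijGroup ?C)"
      by (rule subgroup_PL_fixing[OF pl_polyhedron_cbox])
    show "E \<circ> diag \<in> hom integer_group ?G" by (rule hom_compose[OF diag E(1)])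
    have diag_mem: "diag k \<in> PL_fixing ?C (frontier ?C)" for k
      using diag by (auto simp: hom_def)
    then have "inj_on E (range diag)" using E(2) by (auto intro: inj_on_subset)
    then show "inj_on (E \<circ> diag) (carrier integer_group)"
      using diag_inj by (simp add: comp_inj_on)
    show "(E \<circ> diag) k x = x" if "x \<in> ?C - ?U" for k x
      using E(3)[OF diag_mem that] by simp
    show "?U \<noteq> {}" using half by blast
    show "\<tau> t x \<notin> ?U" if t: "t \<in> carrier ?T" "t \<noteq> \<one>\<^bsub>?T\<^esub>" and x: "x \<in> ?U" for t x
    proof -
      have "\<exists>j<n. t j \<noteq> 0"
        using t by (auto simp: PiE_iff extensional_def fun_eq_iff split: if_splits)
      then obtain i where "t (e i) \<noteq> 0"
        using e unfolding bij_betw_def by (metis imageE lessThan_iff)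
      then show ?thesis
        using multiflow_moves_off_core[of "\<lambda>i. t (e i)" i x] x core_sub by (auto simp: \<tau>_def)
    qed
  qed (rule group_integer_group T \<tau> core_sub)+
  show ?thesis
    using wreath_product_embeds unfolding ZW_def .
qed

section \<open>Cubes and doubled cubes\<close>

text \<open>The homeomorphism with the standard cube is only topological, so the conclusion rests on
  invariance of domain.\<close>
lemma cube_polyhedron_interior_nonempty:
  fixes I :: "(real ^ 'n) set"
  assumes "cube_polyhedron I"
  shows "interior I \<noteq> {}"
proof -
  have "cbox (0::real^'n) 1 homeomorphic I"
    using assms unfolding cube_polyhedron_def by (meson homeomorphic_sym)
  then obtain f g where f: "homeomorphism (cbox (0::real^'n) 1) I f g"
    unfolding homeomorphic_def by blast
  let ?B = "box (0::real^'n) 1"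
  have sub: "?B \<subseteq> cbox 0 1" by (rule box_subset_cbox)
  have "inj_on f (cbox 0 1)"
    using homeomorphism_apply1[OF f] by (rule inj_on_inverseI)
  then have "open (f ` ?B)"
    using sub homeomorphism_cont1[OF f]
    by (intro invariance_of_domain) (auto intro: continuous_on_subset inj_on_subset)
  moreover have "f ` ?B \<subseteq> I" using sub homeomorphism_image1[OF f] by blast
  moreover have "?B \<noteq> {}"
    using interval_ne_empty_cart(2)[of "0::real^'n" 1] by simp
  ultimately show ?thesis
    using interior_maximal[of "f ` ?B" I] by blast
qed

lemma pl_on_hyperplane_reflection:
  assumes "pl_polyhedron P"
  shows "pl_on P (hyperplane_reflection a b)"
proof -
  let ?L = "\<lambda>x. x - (2 * (a \<bullet> x) / (a \<bullet> a)) *\<^sub>R a"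
  have "linear ?L"
    by (rule linearI) (simp_all add: inner_add_right algebra_simps add_divide_distrib)
  from pl_on_affine[OF assms this, of "(2 * b / (a \<bullet> a)) *\<^sub>R a"]
  show ?thesis
    by (rule pl_on_cong) (simp add: hyperplane_reflection_def algebra_simps diff_divide_distrib)
qed

lemma group_ZW: "group (ZW n)"
  unfolding ZW_def by (rule group_wreath_product) auto

lemma inj_hom_PL_groupI:
  assumes P: "pl_polyhedron P" and \<phi>: "\<phi> \<in> hom (ZW n) (PL_group_fixing P A)" "inj_on \<phi> (carrier (ZW n))"
  shows "\<exists>\<phi>. group_hom (ZW n) (PL_group P) \<phi> \<and> inj_on \<phi> (carrier (ZW n))"
proof -
  have "\<phi> \<in> hom (ZW n) (PL_group P)"
    using \<phi>(1) by (auto simp: hom_def PL_group_eq PL_fixing_def)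
  then have "group_hom (ZW n) (PL_group P) \<phi>"
    using group_ZW group_PL_group_fixing[OF P]
    by (simp add: group_hom_def group_hom_axioms_def PL_group_eq)
  then show ?thesis using \<phi>(2) by blast
qed

theorem theorem1p6:
  fixes n :: nat
    and I :: "(real ^ 'n) set"
  assumes "n > 0"
    and "CARD('n) = n"
    and "CARD('m) = n + 1"
    and "cube_polyhedron I"
  shows "(\<exists>\<phi>. group_hom (ZW n) (PL_group I) \<phi> \<and> inj_on \<phi> (carrier (ZW n))) \<and>
         (\<forall>S :: (real ^ 'm) set. doubled_cube_sphere I S \<longrightarrow>
           (\<exists>\<psi>. group_hom (ZW n) (PL_group S) \<psi> \<and> inj_on \<psi> (carrier (ZW n))))"
proof -
  let ?C = "big_cube :: (real ^ 'n) set"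
  have I: "pl_polyhedron I" using assms(4) by (simp add: cube_polyhedron_def)
  obtain \<phi> where \<phi>: "\<phi> \<in> hom (ZW n) (PL_group_fixing ?C (frontier ?C))"
    "inj_on \<phi> (carrier (ZW n))"
    using ZW_embeds_in_cube[OF assms(2)] by blast
  obtain E where E: "E \<in> hom (PL_group_fixing ?C (frontier ?C)) (PL_group_fixing I (frontier I))"
    "inj_on E (PL_fixing ?C (frontier ?C))"
    using pl_cube_embedding[OF I open_interior interior_subset
        cube_polyhedron_interior_nonempty[OF assms(4)] big_cube_interior_nonempty, of "frontier I"]
    by (auto simp: frontier_def)
  define \<phi>I where "\<phi>I = E \<circ> \<phi>"
  have "\<phi> ` carrier (ZW n) \<subseteq> PL_fixing ?C (frontier ?C)"
    using \<phi>(1) by (auto simp: hom_def)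
  then have \<phi>I: "\<phi>I \<in> hom (ZW n) (PL_group_fixing I (frontier I))" "inj_on \<phi>I (carrier (ZW n))"
    unfolding \<phi>I_def using hom_compose[OF \<phi>(1) E(1)] \<phi>(2) E(2)
    by (auto intro: comp_inj_on inj_on_subset)
  have "\<exists>\<psi>. group_hom (ZW n) (PL_group S) \<psi> \<and> inj_on \<psi> (carrier (ZW n))"
    if S: "doubled_cube_sphere I S" for S :: "(real ^ 'm) set"
  proof -
    obtain a b h J where plS: "pl_polyhedron S" and h: "pl_homeomorphism I J h"
      and SJ: "S = J \<union> hyperplane_reflection a b ` J"
      and glue: "J \<inter> hyperplane_reflection a b ` J = h ` frontier I"
      using S unfolding doubled_cube_sphere_def by blast
    obtain g where "homeomorphism I J h g" and plh: "pl_on I h"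
      using h unfolding pl_homeomorphism_def by blast
    then have J: "h ` I = J" and inj: "inj_on h I"
      by (auto simp: homeomorphism_def intro: inj_on_inverseI)
    have K: "pl_polyhedron (hyperplane_reflection a b ` J)"
      using pl_polyhedron_image[OF pl_on_hyperplane_reflection] pl_polyhedron_image[OF plh]
      unfolding J by blast
    have sub: "frontier I \<subseteq> I"
      by (intro frontier_subset_closed compact_imp_closed pl_polyhedron_imp_compact I)
    obtain D where D: "D \<in> hom (PL_group_fixing I (frontier I)) (PL_group_fixing S {})"
      "inj_on D (PL_fixing I (frontier I))"
      using pl_extension_by_identity[OF plh inj K sub, of "{}"] glue
      unfolding J SJ by auto
    have "\<phi>I ` carrier (ZW n) \<subseteq> PL_fixing I (frontier I)"
      using \<phi>I(1) by (auto simp: hom_def)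
    then have "inj_on (D \<circ> \<phi>I) (carrier (ZW n))"
      using \<phi>I(2) D(2) by (auto intro: comp_inj_on inj_on_subset)
    then show ?thesis
      using inj_hom_PL_groupI[OF plS hom_compose[OF \<phi>I(1) D(1)]] by blast
  qed
  then show ?thesis using inj_hom_PL_groupI[OF I \<phi>I] by blast
qed

end
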